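(* Suppose $A$ is generated by $a_1,\dots,a_m$ and let $r>0$. For a linear functional $L:A\to\mathbb R$ such that $L(1)=1$ the following conditions are equivalent: (1) $L$ is positive semidefinite and $$\sup_{n\in\mathbb N}\sqrt[2n]{L\big((a_1^2+\dots+a_m^2)^{2n}\big)}\le r^2;$$ (2) $L$ is positive semidefinite and $r^2L(b^2)-L\big(b^2(a_1^2+\dots+a_m^2)\big)\ge 0$ for all $b\in A$; (3) there is a unique positive Radon measure $\mu$ on $$K=\{\alpha\in X(A):|\alpha(a_1)|^2+\dots+|\alpha(a_m)|^2\le r^2\}$$ such that $L(a)=\int_K\alpha(a)\,d\mu(\alpha)$ for all $a\in A$.
   Context: $A$ is a unital commutative $\mathbb R$-algebra and $X(A)$ is the set of all (unital) $\mathbb R$-algebra homomorphisms $A\to\mathbb R$, assumed non-empty and endowed with the topology of pointwise convergence. $\mathbb N=\{1,2,\dots\}$. A linear functional $L:A\to\mathbb R$ is positive semidefinite if $L(a^2)\ge 0$ for all $a\in A$. Generated means generated as a unital $\mathbb R$-algebra. *)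

theory Defs
  imports "HOL-Analysis.Analysis"
begin

definition subalgebra_1 :: "'a::{comm_ring_1,real_algebra_1} set \<Rightarrow> bool" where
  "subalgebra_1 S \<longleftrightarrow> subspace S \<and> 1 \<in> S \<and> (\<forall>x\<in>S. \<forall>y\<in>S. x * y \<in> S)"

definition generates_algebra :: "'a::{comm_ring_1,real_algebra_1} set \<Rightarrow> bool" where
  "generates_algebra G \<longleftrightarrow> subalgebra_1 hull G = UNIV"

(* The type 'a => real carries the product topology, i.e. the topology of pointwise
   convergence, so the topology of characters is the induced subspace topology. *)
definition characters :: "('a::{comm_ring_1,real_algebra_1} \<Rightarrow> real) set" where
  "characters = {\<alpha>. linear \<alpha> \<and> \<alpha> 1 = 1 \<and> (\<forall>x y. \<alpha> (x * y) = \<alpha> x * \<alpha> y)}"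

definition pos_semidef :: "('a::{comm_ring_1,real_algebra_1} \<Rightarrow> real) \<Rightarrow> bool" where
  "pos_semidef L \<longleftrightarrow> (\<forall>a. L (a\<^sup>2) \<ge> 0)"

(* For Hausdorff spaces: a locally finite measure on the Borel sigma-algebra of the subspace K that is inner regular
   with respect to compact sets; this sigma-algebra is the trace on K of that of the ambient space. *)
definition radon_measure_on :: "'b::topological_space set \<Rightarrow> 'b measure \<Rightarrow> bool" where
  "radon_measure_on K \<mu> \<longleftrightarrow>
     sets \<mu> = sets (restrict_space borel K) \<and>
     (\<forall>x\<in>K. \<exists>U. open U \<and> x \<in> U \<and> emeasure \<mu> (U \<inter> K) < \<infinity>) \<and>
     (\<forall>B\<in>sets \<mu>. emeasure \<mu> B = (SUP C\<in>{C. compact C \<and> C \<subseteq> B}. emeasure \<mu> C))"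

end

theory Submission
  imports Defs
begin

text \<open>
  Write \<open>\<rho>\<close> for \<open>r\<^sup>2\<close>. Condition (2) says that multiplication by \<open>s\<close>, the sum of the squares of the
  generators, is bounded by \<open>\<rho>\<close> for the positive semidefinite form \<open>(x, y) \<mapsto> L (x * y)\<close>, and condition
  (1) says that the moments of \<open>s\<close> grow at most like the powers of \<open>\<rho>\<close>. These agree for the reason
  that the norm of a symmetric operator equals its spectral radius: repeated squaring with the
  Cauchy--Schwarz inequality turns growth into a bound (\<open>weighted_bound_of_moment_growth\<close>), and
  peeling off one factor \<open>s\<close> at a time turns the bound into growth
  (\<open>moment_bound_of_weighted_bound\<close>).

  A representing measure on \<open>K\<close> gives (2) because \<open>\<alpha> b ^ 2 * (\<rho> - \<alpha> s)\<close> is nonnegative on \<open>K\<close>. For the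
  converse, the normalized functionals with property (2) form a convex set, \<open>ball_states s \<rho>\<close>, which
  is compact for pointwise convergence: by finite generation each element of the algebra is
  bounded uniformly over all of them. An extreme functional \<open>L\<close> of this set is multiplicative, since
  for each \<open>c\<close> it is a convex combination of the normalization of \<open>y \<mapsto> L (c\<^sup>2 * y)\<close> and another member;
  that the second member satisfies the bound by \<open>\<rho>\<close> is again the spectral radius argument, applied to
  \<open>y \<mapsto> L ((\<rho> - s) * y)\<close> (\<open>ball_states_split\<close>). So the extreme functionals are the points of \<open>K\<close>, and
  \<open>L x \<ge> 0\<close> whenever \<open>x\<close> is nonnegative on \<open>K\<close> (\<open>nonneg_of_nonneg_on_ball_characters\<close>). The
  extreme functional needed for a given \<open>x\<close> comes from two optimizations: minimize the value at \<open>x\<close>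
  over the compact set, and among the minimizers maximize the sum of the squares of the values at
  the generators.

  Hence \<open>L\<close> is a positive functional on an algebra of continuous functions on the compact space \<open>K\<close>,
  and that algebra is uniformly dense by the Stone--Weierstrass theorem (\<open>characters_dense\<close>). A Riesz
  representation theorem for positive functionals on dense spaces of continuous functions
  (\<open>representing_measure_exists\<close>, \<open>representing_measure_unique\<close>) gives the measure. The values at the
  generators embed \<open>K\<close> into a metric space; so closed subsets of \<open>K\<close> are zero sets of continuous
  functions, on which Borel measurability and uniqueness rest, and the measure is inner regular.
\<close>

section \<open>Moment growth and weighted bounds\<close>

lemma Cauchy_Schwarz_pos_semidef:
  assumes lin: "linear L" and psd: "pos_semidef L"
  shows "(L (x * y))\<^sup>2 \<le> L (x\<^sup>2) * L (y\<^sup>2)"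
proof -
  have quad: "0 \<le> L (x\<^sup>2) + 2 * t * L (x * y) + t\<^sup>2 * L (y\<^sup>2)" for t
  proof -
    have "(x + t *\<^sub>R y)\<^sup>2 = x\<^sup>2 + (2 * t) *\<^sub>R (x * y) + t\<^sup>2 *\<^sub>R y\<^sup>2"
      by (simp add: power2_eq_square algebra_simps)
        (metis mult.assoc mult.commute mult_2_right scaleR_2 scaleR_scaleR)
    then have "L ((x + t *\<^sub>R y)\<^sup>2) = L (x\<^sup>2) + 2 * t * L (x * y) + t\<^sup>2 * L (y\<^sup>2)"
      by (simp add: linear_add[OF lin] linear_scale[OF lin])
    then show ?thesis using psd unfolding pos_semidef_def by metis
  qed
  have nonneg: "0 \<le> L (x\<^sup>2)" "0 \<le> L (y\<^sup>2)" using psd by (auto simp: pos_semidef_def)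
  show ?thesis
  proof (cases "L (y\<^sup>2) = 0")
    case True
    \<comment> \<open>a linear function of t can be nonnegative everywhere only if its slope vanishes\<close>
    have "L (x * y) = 0"
    proof (rule ccontr)
      assume nz: "L (x * y) \<noteq> 0"
      have "0 \<le> L (x\<^sup>2) + 2 * (- (L (x\<^sup>2) + 1) / (2 * L (x * y))) * L (x * y)"
        using quad[of "- (L (x\<^sup>2) + 1) / (2 * L (x * y))"] True by simp
      also have "\<dots> = -1" using nz by (simp add: field_simps)
      finally show False by simp
    qed
    then show ?thesis using True by simp
  next
    case False
    then have pos: "0 < L (y\<^sup>2)" using nonneg by simp
    have "0 \<le> L (x\<^sup>2) - (L (x * y))\<^sup>2 / L (y\<^sup>2)"
      using quad[of "- L (x * y) / L (y\<^sup>2)"] pos by (simp add: field_simps power2_eq_square)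
    then show ?thesis using pos by (simp add: field_simps)
  qed
qed

text \<open>
  This is the estimate of an operator norm by a spectral radius. The numbers \<open>u k = L (b\<^sup>2 * y ^ (2 ^ k))\<close>
  satisfy \<open>(u k)\<^sup>2 \<le> L (b\<^sup>2) * u (Suc k)\<close> by the Cauchy--Schwarz inequality, so the \<open>2 ^ k\<close>-th power of
  \<open>u 0 / L (b\<^sup>2)\<close> is at most \<open>u k / L (b\<^sup>2)\<close>; a second use of Cauchy--Schwarz separates \<open>b\<close> from \<open>y\<close> and
  bounds \<open>u k\<close> by a constant times \<open>\<rho> ^ (2 ^ k)\<close>. The constant disappears in the limit.
\<close>

lemma weighted_bound_of_moment_growth:
  assumes lin: "linear L" and psd: "pos_semidef L" and "0 < \<rho>"
    and growth: "\<And>n. n \<ge> 1 \<Longrightarrow> L (y ^ (2 * n)) \<le> D * \<rho> ^ (2 * n)"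
  shows "L (b\<^sup>2 * y) \<le> \<rho> * L (b\<^sup>2)"
proof (cases "0 < L (b\<^sup>2 * y)")
  case False
  then show ?thesis using psd \<open>0 < \<rho>\<close> by (smt (verit) mult_nonneg_nonneg pos_semidef_def)
next
  case True
  define q where "q = L (b\<^sup>2)"
  define u where "u k = L (b\<^sup>2 * y ^ (2 ^ k))" for k :: nat
  have step: "(u k)\<^sup>2 \<le> q * u (Suc k)" for k
  proof -
    have "(L (b * (b * y ^ (2 ^ k))))\<^sup>2 \<le> L (b\<^sup>2) * L ((b * y ^ (2 ^ k))\<^sup>2)"
      by (rule Cauchy_Schwarz_pos_semidef[OF lin psd])
    moreover have "b * (b * y ^ (2 ^ k)) = b\<^sup>2 * y ^ (2 ^ k)"
      by (simp add: power2_eq_square mult.assoc)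
    moreover have "(b * y ^ (2 ^ k))\<^sup>2 = b\<^sup>2 * y ^ (2 ^ Suc k)"
      by (simp add: power_mult_distrib mult.commute flip: power_mult)
    ultimately show ?thesis by (simp add: u_def q_def)
  qed
  have "0 \<le> q" using psd by (simp add: q_def pos_semidef_def)
  moreover have "q \<noteq> 0" using step[of 0] True by (auto simp: u_def)
  ultimately have "0 < q" by simp
  define v where "v k = u k / q" for k
  have v_pos: "0 < v 0" using True \<open>0 < q\<close> by (simp add: v_def u_def)
  have v_step: "(v k)\<^sup>2 \<le> v (Suc k)" for k
    using step[of k] \<open>0 < q\<close> by (simp add: v_def field_simps power2_eq_square)
  have v_power: "v 0 ^ (2 ^ k) \<le> v k" for k
  proof (induction k)
    case (Suc k)
    have "v 0 ^ (2 ^ Suc k) = (v 0 ^ (2 ^ k))\<^sup>2" by (simp add: mult.commute flip: power_mult)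
    also have "\<dots> \<le> (v k)\<^sup>2" using Suc v_pos by (intro power_mono) auto
    also have "\<dots> \<le> v (Suc k)" by (rule v_step)
    finally show ?case .
  qed simp
  define c where "c = sqrt (L ((b\<^sup>2)\<^sup>2) * D) / q"
  have v_upper: "v k \<le> c * \<rho> ^ (2 ^ k)" for k
  proof -
    have "(u k)\<^sup>2 \<le> L ((b\<^sup>2)\<^sup>2) * L ((y ^ (2 ^ k))\<^sup>2)"
      unfolding u_def by (rule Cauchy_Schwarz_pos_semidef[OF lin psd])
    also have "\<dots> \<le> L ((b\<^sup>2)\<^sup>2) * (D * \<rho> ^ (2 * 2 ^ k))"
    proof (rule mult_left_mono)
      show "L ((y ^ (2 ^ k))\<^sup>2) \<le> D * \<rho> ^ (2 * 2 ^ k)"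
        using growth[of "2 ^ k"] by (simp add: mult.commute flip: power_mult)
      show "0 \<le> L ((b\<^sup>2)\<^sup>2)" using psd unfolding pos_semidef_def by blast
    qed
    also have "\<dots> = (L ((b\<^sup>2)\<^sup>2) * D) * (\<rho> ^ (2 ^ k))\<^sup>2"
      by (simp add: mult.commute flip: power_mult)
    finally have "\<bar>u k\<bar> \<le> sqrt ((L ((b\<^sup>2)\<^sup>2) * D) * (\<rho> ^ (2 ^ k))\<^sup>2)"
      by (simp add: real_le_rsqrt)
    then have "u k \<le> sqrt (L ((b\<^sup>2)\<^sup>2) * D) * \<rho> ^ (2 ^ k)"
      using \<open>0 < \<rho>\<close> by (simp add: real_sqrt_mult)
    then show ?thesis using \<open>0 < q\<close> by (simp add: v_def c_def divide_right_mono)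
  qed
  have "v 0 / \<rho> \<le> 1"
  proof (rule ccontr)
    assume "\<not> v 0 / \<rho> \<le> 1"
    then have gt: "1 < v 0 / \<rho>" by simp
    obtain n where n: "c < (v 0 / \<rho>) ^ n" using real_arch_pow[OF gt] by blast
    have "(v 0 / \<rho>) ^ n \<le> (v 0 / \<rho>) ^ (2 ^ n)"
      using gt by (intro power_increasing) auto
    also have "\<dots> \<le> c"
      using order_trans[OF v_power v_upper, of n] \<open>0 < \<rho>\<close>
      by (simp add: power_divide divide_le_eq)
    finally show False using n by simp
  qed
  then show ?thesis using \<open>0 < \<rho>\<close> \<open>0 < q\<close> by (simp add: v_def u_def q_def field_simps)
qed

text \<open>
  The hypothesis allows one factor \<open>s\<close> to be traded for \<open>\<rho>\<close> in front of a square, hence in front of a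
  sum of squares. An even power of \<open>s\<close> is a square, and an odd one is a sum of squares because \<open>s\<close> is.
\<close>

lemma moment_bound_of_weighted_bound:
  fixes a :: "'i \<Rightarrow> 'a::{comm_ring_1,real_algebra_1}" and L :: "'a \<Rightarrow> real"
  assumes lin: "linear L" and "L 1 = 1" and "0 \<le> \<rho>"
    and s: "s = (\<Sum>i\<in>I. (a i)\<^sup>2)"
    and bound: "\<And>b. L (b\<^sup>2 * s) \<le> \<rho> * L (b\<^sup>2)"
  shows "L (s ^ n) \<le> \<rho> ^ n"
proof (induction n)
  case 0
  then show ?case using assms(2) by simp
next
  case (Suc n)
  have "L (s ^ Suc n) \<le> \<rho> * L (s ^ n)"
  proof (cases "even n")
    case True
    then obtain k where "n = 2 * k" by blast
    then have "s ^ n = (s ^ k)\<^sup>2" by (simp add: mult.commute flip: power_mult)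
    then show ?thesis using bound[of "s ^ k"] by (simp add: mult.commute)
  next
    case False
    then obtain k where n: "n = Suc (2 * k)" by (auto elim: oddE)
    have expand: "s ^ n = (\<Sum>i\<in>I. (s ^ k * a i)\<^sup>2)"
    proof -
      have "s ^ n = (s ^ k)\<^sup>2 * s" by (simp add: n mult.commute flip: power_mult)
      then show ?thesis by (subst (asm) (3) s) (simp add: sum_distrib_left power_mult_distrib)
    qed
    have "L (s ^ Suc n) = L (\<Sum>i\<in>I. (s ^ k * a i)\<^sup>2 * s)"
      by (simp add: expand mult.commute sum_distrib_left)
    also have "\<dots> = (\<Sum>i\<in>I. L ((s ^ k * a i)\<^sup>2 * s))" by (rule linear_sum[OF lin])
    also have "\<dots> \<le> (\<Sum>i\<in>I. \<rho> * L ((s ^ k * a i)\<^sup>2))" by (intro sum_mono bound)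
    also have "\<dots> = \<rho> * L (s ^ n)" by (simp add: expand linear_sum[OF lin] sum_distrib_left)
    finally show ?thesis .
  qed
  also have "\<dots> \<le> \<rho> * \<rho> ^ n" using Suc \<open>0 \<le> \<rho>\<close> by (rule mult_left_mono)
  finally show ?case by simp
qed

lemma SUP_root_le_iff:
  fixes u :: "nat \<Rightarrow> real"
  assumes "0 \<le> c"
  shows "(SUP n\<in>{1..}. ereal (root (2 * n) (u n))) \<le> ereal c \<longleftrightarrow> (\<forall>n\<ge>1. u n \<le> c ^ (2 * n))"
proof -
  have "root (2 * n) (u n) \<le> c \<longleftrightarrow> u n \<le> c ^ (2 * n)" if "n \<ge> 1" for n
  proof -
    have "root (2 * n) (c ^ (2 * n)) = c"
      using that assms by (simp add: real_root_power_cancel)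
    then show ?thesis
      using that real_root_le_iff[of "2 * n" "u n" "c ^ (2 * n)"] by simp
  qed
  then show ?thesis by (auto simp: SUP_le_iff)
qed

lemma moment_growth_iff_weighted_bound:
  fixes a :: "'i \<Rightarrow> 'a::{comm_ring_1,real_algebra_1}"
  assumes "linear L" and "L 1 = 1" and psd: "pos_semidef L" and "0 < \<rho>" and s: "s = (\<Sum>i\<in>I. (a i)\<^sup>2)"
  shows "(\<forall>n\<ge>1. L (s ^ (2 * n)) \<le> \<rho> ^ (2 * n)) \<longleftrightarrow> (\<forall>b. L (b\<^sup>2 * s) \<le> \<rho> * L (b\<^sup>2))"
proof
  assume "\<forall>n\<ge>1. L (s ^ (2 * n)) \<le> \<rho> ^ (2 * n)"
  then show "\<forall>b. L (b\<^sup>2 * s) \<le> \<rho> * L (b\<^sup>2)"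
    using \<open>0 < \<rho>\<close>
    by (intro allI weighted_bound_of_moment_growth[OF assms(1) psd, where D = 1]) simp_all
next
  assume "\<forall>b. L (b\<^sup>2 * s) \<le> \<rho> * L (b\<^sup>2)"
  then have "L (s ^ n) \<le> \<rho> ^ n" for n
    using \<open>0 < \<rho>\<close> by (intro moment_bound_of_weighted_bound[OF assms(1,2) _ s]) simp_all
  then show "\<forall>n\<ge>1. L (s ^ (2 * n)) \<le> \<rho> ^ (2 * n)" by blast
qed

section \<open>Compactness and extreme points of the states of a ball\<close>

lemma generates_algebra_induct [consumes 1, case_names generator zero one add scale mult]:
  assumes "generates_algebra G" and "\<And>g. g \<in> G \<Longrightarrow> P g" and "P 0" and "P 1"
    and "\<And>x y. P x \<Longrightarrow> P y \<Longrightarrow> P (x + y)" and "\<And>c x. P x \<Longrightarrow> P (c *\<^sub>R x)"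
    and "\<And>x y. P x \<Longrightarrow> P y \<Longrightarrow> P (x * y)"
  shows "P x"
proof -
  have "subalgebra_1 {x. P x}"
    using assms(3-) by (auto simp: subalgebra_1_def subspace_def)
  then have "subalgebra_1 hull G \<subseteq> {x. P x}"
    using assms(2) by (intro hull_minimal) auto
  then show ?thesis using assms(1) by (auto simp: generates_algebra_def)
qed

text \<open>
  The states of the algebra that are supported, in the sense of condition (2), in the ball in which \<open>s \<le> \<rho>\<close>.
\<close>

definition ball_states :: "'a::{comm_ring_1,real_algebra_1} \<Rightarrow> real \<Rightarrow> ('a \<Rightarrow> real) set" where
  "ball_states s \<rho> = {L. linear L \<and> L 1 = 1 \<and> pos_semidef L \<and> (\<forall>b. L (b\<^sup>2 * s) \<le> \<rho> * L (b\<^sup>2))}"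

text \<open>
  Each instance of a conjunct is a closed condition on finitely many values of \<open>L\<close>; so the set is closed
  for pointwise convergence.
\<close>

lemma ball_states_iff:
  "L \<in> ball_states s \<rho> \<longleftrightarrow> (\<forall>x y. L (x + y) = L x + L y) \<and> (\<forall>c x. L (c *\<^sub>R x) = c * L x) \<and>
     L 1 = 1 \<and> (\<forall>b. 0 \<le> L (b\<^sup>2)) \<and> (\<forall>b. L (b\<^sup>2 * s) \<le> \<rho> * L (b\<^sup>2))"
  by (auto simp: ball_states_def pos_semidef_def linear_iff)

text \<open>
  The elements \<open>c\<close> that act boundedly in this sense form a subalgebra, which contains each generator
  because its square is dominated by \<open>s\<close>. The bound does not depend on \<open>L\<close>, as compactness requires.
\<close>

lemma ball_states_uniform_bound:
  fixes a :: "'i \<Rightarrow> 'a::{comm_ring_1,real_algebra_1}"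
  assumes gen: "generates_algebra (a ` I)" and "finite I" and s: "s = (\<Sum>i\<in>I. (a i)\<^sup>2)" and "0 \<le> \<rho>"
  shows "\<exists>N\<ge>0. \<forall>L\<in>ball_states s \<rho>. \<forall>b. L (c\<^sup>2 * b\<^sup>2) \<le> N * L (b\<^sup>2)"
  using gen
proof (induction c rule: generates_algebra_induct)
  case (generator g)
  then obtain i where i: "i \<in> I" "g = a i" by auto
  have "L (g\<^sup>2 * b\<^sup>2) \<le> \<rho> * L (b\<^sup>2)" if L: "L \<in> ball_states s \<rho>" for L b
  proof -
    have lin: "linear L" and psd: "\<And>b. 0 \<le> L (b\<^sup>2)" and bd: "L (b\<^sup>2 * s) \<le> \<rho> * L (b\<^sup>2)"
      using L by (auto simp: ball_states_def pos_semidef_def)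
    have "b\<^sup>2 * s = (\<Sum>j\<in>I. (a j * b)\<^sup>2)"
      by (simp add: s sum_distrib_left power_mult_distrib mult.commute)
    then have "L (b\<^sup>2 * s) = (\<Sum>j\<in>I. L ((a j * b)\<^sup>2))" by (simp add: linear_sum[OF lin])
    then have "L ((a i * b)\<^sup>2) \<le> L (b\<^sup>2 * s)"
      using member_le_sum[OF i(1), of "\<lambda>j. L ((a j * b)\<^sup>2)"] \<open>finite I\<close> psd by simp
    then show ?thesis using bd by (simp add: i power_mult_distrib)
  qed
  then show ?case using \<open>0 \<le> \<rho>\<close> by blast
next
  case zero
  have "\<forall>L\<in>ball_states s \<rho>. \<forall>b. L (0\<^sup>2 * b\<^sup>2) \<le> 0 * L (b\<^sup>2)"
    by (auto simp: ball_states_def linear_0)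
  then show ?case by blast
next
  case one
  have "\<forall>L\<in>ball_states s \<rho>. \<forall>b. L (1\<^sup>2 * b\<^sup>2) \<le> 1 * L (b\<^sup>2)" by simp
  then show ?case by (intro exI[of _ 1]) auto
next
  case (add x y)
  then obtain N M where N: "0 \<le> N" "\<And>L b. L \<in> ball_states s \<rho> \<Longrightarrow> L (x\<^sup>2 * b\<^sup>2) \<le> N * L (b\<^sup>2)"
    and M: "0 \<le> M" "\<And>L b. L \<in> ball_states s \<rho> \<Longrightarrow> L (y\<^sup>2 * b\<^sup>2) \<le> M * L (b\<^sup>2)" by metis
  have "L ((x + y)\<^sup>2 * b\<^sup>2) \<le> (2 * N + 2 * M) * L (b\<^sup>2)" if L: "L \<in> ball_states s \<rho>" for L b
  proof -
    have lin: "linear L" and psd: "\<And>b. 0 \<le> L (b\<^sup>2)"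
      using L by (auto simp: ball_states_def pos_semidef_def)
    have "(x + y)\<^sup>2 * b\<^sup>2 + ((x - y) * b)\<^sup>2 = 2 *\<^sub>R (x\<^sup>2 * b\<^sup>2) + 2 *\<^sub>R (y\<^sup>2 * b\<^sup>2)"
      by (simp add: power2_eq_square algebra_simps scaleR_2)
    then have "L ((x + y)\<^sup>2 * b\<^sup>2) + L (((x - y) * b)\<^sup>2) = 2 * L (x\<^sup>2 * b\<^sup>2) + 2 * L (y\<^sup>2 * b\<^sup>2)"
      by (simp add: linear_scale[OF lin] flip: linear_add[OF lin])
        (simp add: linear_add[OF lin] linear_scale[OF lin])
    then show ?thesis using psd[of "(x - y) * b"] N(2)[OF L, of b] M(2)[OF L, of b]
      by (simp add: algebra_simps)
  qed
  then show ?case using N(1) M(1) by (intro exI[of _ "2 * N + 2 * M"]) auto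
next
  case (scale c x)
  then obtain N where N: "0 \<le> N" "\<And>L b. L \<in> ball_states s \<rho> \<Longrightarrow> L (x\<^sup>2 * b\<^sup>2) \<le> N * L (b\<^sup>2)"
    by metis
  have "L ((c *\<^sub>R x)\<^sup>2 * b\<^sup>2) \<le> (c\<^sup>2 * N) * L (b\<^sup>2)" if L: "L \<in> ball_states s \<rho>" for L b
  proof -
    have "L ((c *\<^sub>R x)\<^sup>2 * b\<^sup>2) = c\<^sup>2 * L (x\<^sup>2 * b\<^sup>2)"
      using L by (simp add: ball_states_def linear_scale power2_eq_square)
    then show ?thesis using mult_left_mono[OF N(2)[OF L, of b], of "c\<^sup>2"] by simp
  qed
  then show ?case using N(1) by (intro exI[of _ "c\<^sup>2 * N"]) auto
next
  case (mult x y)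
  then obtain N M where N: "0 \<le> N" "\<And>L b. L \<in> ball_states s \<rho> \<Longrightarrow> L (x\<^sup>2 * b\<^sup>2) \<le> N * L (b\<^sup>2)"
    and M: "0 \<le> M" "\<And>L b. L \<in> ball_states s \<rho> \<Longrightarrow> L (y\<^sup>2 * b\<^sup>2) \<le> M * L (b\<^sup>2)" by metis
  have "L ((x * y)\<^sup>2 * b\<^sup>2) \<le> (N * M) * L (b\<^sup>2)" if L: "L \<in> ball_states s \<rho>" for L b
  proof -
    have "L ((x * y)\<^sup>2 * b\<^sup>2) = L (x\<^sup>2 * (y * b)\<^sup>2)" by (simp add: power_mult_distrib mult.assoc)
    also have "\<dots> \<le> N * L ((y * b)\<^sup>2)" by (rule N(2)[OF L])
    also have "\<dots> \<le> N * (M * L (b\<^sup>2))"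
      using M(2)[OF L, of b] N(1) by (intro mult_left_mono) (auto simp: power_mult_distrib)
    finally show ?thesis by simp
  qed
  then show ?case using N(1) M(1) by (intro exI[of _ "N * M"]) auto
qed

lemma compact_function_box:
  fixes B :: "'a \<Rightarrow> real"
  shows "compact {f. \<forall>x. \<bar>f x\<bar> \<le> B x}"
proof -
  have "compactin (product_topology (\<lambda>x. euclidean) UNIV) (PiE UNIV (\<lambda>x. {- B x..B x}))"
    by (subst compactin_PiE) auto
  then have "compact (PiE UNIV (\<lambda>x. {- B x..B x}))"
    by (simp add: euclidean_product_topology)
  moreover have "PiE UNIV (\<lambda>x. {- B x..B x}) = {f. \<forall>x. \<bar>f x\<bar> \<le> B x}"
    by (auto simp: PiE_iff abs_le_iff) (smt (verit))+
  ultimately show ?thesis by simp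
qed

lemma compact_ball_states:
  fixes a :: "'i \<Rightarrow> 'a::{comm_ring_1,real_algebra_1}"
  assumes gen: "generates_algebra (a ` I)" and "finite I" and s: "s = (\<Sum>i\<in>I. (a i)\<^sup>2)" and "0 \<le> \<rho>"
  shows "compact (ball_states s \<rho>)"
proof -
  obtain N where N: "\<And>c. 0 \<le> N c" "\<And>c L b. L \<in> ball_states s \<rho> \<Longrightarrow> L (c\<^sup>2 * b\<^sup>2) \<le> N c * L (b\<^sup>2)"
    using ball_states_uniform_bound[OF assms] by metis
  have "\<bar>L c\<bar> \<le> sqrt (N c)" if L: "L \<in> ball_states s \<rho>" for L c
  proof -
    have "(L (c * 1))\<^sup>2 \<le> L (c\<^sup>2) * L (1\<^sup>2)"
      using L by (intro Cauchy_Schwarz_pos_semidef) (auto simp: ball_states_def)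
    then have "(L c)\<^sup>2 \<le> N c"
      using N(2)[OF L, of c 1] L by (simp add: ball_states_def)
    then show ?thesis by (simp add: real_le_rsqrt)
  qed
  then have sub: "ball_states s \<rho> \<subseteq> {f. \<forall>x. \<bar>f x\<bar> \<le> sqrt (N x)}" by blast
  have "closed {L. L \<in> ball_states s \<rho>}"
    unfolding ball_states_iff
    by (intro closed_Collect_conj closed_Collect_all closed_Collect_eq closed_Collect_le
        continuous_intros continuous_on_product_coordinates)
  then have "compact ({f. \<forall>x. \<bar>f x\<bar> \<le> sqrt (N x)} \<inter> ball_states s \<rho>)"
    by (intro compact_Int_closed compact_function_box) simp
  moreover have "{f. \<forall>x. \<bar>f x\<bar> \<le> sqrt (N x)} \<inter> ball_states s \<rho> = ball_states s \<rho>"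
    using sub by blast
  ultimately show ?thesis by simp
qed

text \<open>
  The points of the ball: the set \<open>K\<close> of the theorem, in terms of the single element \<open>s\<close>.
\<close>

definition ball_characters :: "'a::{comm_ring_1,real_algebra_1} \<Rightarrow> real \<Rightarrow> ('a \<Rightarrow> real) set" where
  "ball_characters s \<rho> = {\<alpha> \<in> characters. \<alpha> s \<le> \<rho>}"

text \<open>
  Characters satisfy the inequality for every \<open>b\<close> once they satisfy it for \<open>b = 1\<close>, so the points of the
  ball are exactly its multiplicative states, a closed set of states.
\<close>

lemma ball_characters_eq:
  "ball_characters s \<rho> = {\<alpha> \<in> ball_states s \<rho>. \<forall>x y. \<alpha> (x * y) = \<alpha> x * \<alpha> y}" 
proof -
  have "\<alpha> (b\<^sup>2 * s) \<le> \<rho> * \<alpha> (b\<^sup>2)" if "\<alpha> \<in> characters" "\<alpha> s \<le> \<rho>" for \<alpha> b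
  proof -
    have "\<alpha> (b\<^sup>2 * s) = (\<alpha> b)\<^sup>2 * \<alpha> s" "\<alpha> (b\<^sup>2) = (\<alpha> b)\<^sup>2"
      using that by (auto simp: characters_def power2_eq_square)
    then show ?thesis using mult_left_mono[OF that(2), of "(\<alpha> b)\<^sup>2"] by (simp add: mult.commute)
  qed
  moreover have "\<alpha> s \<le> \<rho>" if "\<alpha> \<in> ball_states s \<rho>" for \<alpha>
    using that by (auto simp: ball_states_def dest: spec[of _ 1])
  ultimately show ?thesis
    by (auto simp: ball_characters_def ball_states_def characters_def pos_semidef_def power2_eq_square)
qed

lemma compact_ball_characters:
  assumes "compact (ball_states s \<rho>)"
  shows "compact (ball_characters s \<rho>)"
proof -
  have "closed {\<alpha> :: 'a \<Rightarrow> real. \<forall>x y. \<alpha> (x * y) = \<alpha> x * \<alpha> y}"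
    by (intro closed_Collect_all closed_Collect_eq continuous_intros continuous_on_product_coordinates)
  moreover have "ball_characters s \<rho> = ball_states s \<rho> \<inter> {\<alpha>. \<forall>x y. \<alpha> (x * y) = \<alpha> x * \<alpha> y}"
    by (auto simp: ball_characters_eq)
  ultimately show ?thesis using compact_Int_closed[OF assms] by simp
qed

lemma ball_states_normalize:
  assumes "linear Q" "pos_semidef Q" "\<And>b. Q (b\<^sup>2 * s) \<le> \<rho> * Q (b\<^sup>2)" "0 < Q 1"
  shows "(\<lambda>y. Q y / Q 1) \<in> ball_states s \<rho>"
proof -
  have "Q (b\<^sup>2 * s) / Q 1 \<le> \<rho> * (Q (b\<^sup>2) / Q 1)" for b
    using divide_right_mono[OF assms(3)[of b], of "Q 1"] assms(4) by simp
  then show ?thesis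
    using assms by (auto simp: ball_states_def pos_semidef_def linear_iff add_divide_distrib)
qed

text \<open>
  For an arbitrary \<open>c\<close> with positive value at its square, \<open>L\<close> is a convex combination of these two
  states. For the second one, the inequality with \<open>s\<close> says that \<open>M y = L ((\<rho> - s) * y)\<close> satisfies
  \<open>M (b\<^sup>2 * c\<^sup>2) \<le> N * M (b\<^sup>2)\<close>. It does not follow from the same inequality for \<open>L\<close>, since a product of
  two nonnegative elements need not be a sum of squares; but \<open>M\<close> is positive semidefinite, and its
  moments at \<open>c\<^sup>2\<close> are at most \<open>\<rho>\<close> times those of \<open>L\<close> and so grow at most like the powers of \<open>N\<close>.
\<close>

lemma ball_states_split:
  fixes a :: "'i \<Rightarrow> 'a::{comm_ring_1,real_algebra_1}"
  assumes L: "L \<in> ball_states s \<rho>" and s: "s = (\<Sum>i\<in>I. (a i)\<^sup>2)" and "0 \<le> \<rho>"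
    and N: "\<And>b. L (c\<^sup>2 * b\<^sup>2) \<le> N * L (b\<^sup>2)" and "L (c\<^sup>2) < N" and pos: "0 < L (c\<^sup>2)"
  shows "(\<lambda>y. L (c\<^sup>2 * y) / L (c\<^sup>2)) \<in> ball_states s \<rho>"
    and "(\<lambda>y. (N * L y - L (c\<^sup>2 * y)) / (N - L (c\<^sup>2))) \<in> ball_states s \<rho>"
proof -
  have lin: "linear L" and one: "L 1 = 1" and psd: "\<And>b. 0 \<le> L (b\<^sup>2)"
    and bd: "\<And>b. L (b\<^sup>2 * s) \<le> \<rho> * L (b\<^sup>2)"
    using L by (auto simp: ball_states_def pos_semidef_def)
  have "0 < N" using assms by linarith
  have lin': "linear (\<lambda>y. L (z * y))" for z
    by (intro linearI) (simp_all add: distrib_left linear_add[OF lin] linear_scale[OF lin])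
  have sq: "c\<^sup>2 * b\<^sup>2 = (c * b)\<^sup>2" for b by (simp add: power_mult_distrib)
  show "(\<lambda>y. L (c\<^sup>2 * y) / L (c\<^sup>2)) \<in> ball_states s \<rho>"
    using ball_states_normalize[OF lin'[of "c\<^sup>2"], of s \<rho>] pos psd bd
    by (simp add: pos_semidef_def sq flip: mult.assoc)
  define M where "M y = \<rho> * L y - L (y * s)" for y
  have M_lin: "linear M"
    by (intro linearI) (simp_all add: M_def algebra_simps linear_add[OF lin] linear_scale[OF lin])
  have M_psd: "pos_semidef M" using bd by (simp add: M_def pos_semidef_def)
  have weighted_nonneg: "0 \<le> L (b\<^sup>2 * s)" for b
  proof -
    have "b\<^sup>2 * s = (\<Sum>i\<in>I. (b * a i)\<^sup>2)" by (simp add: s sum_distrib_left power_mult_distrib)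
    then show ?thesis by (simp add: linear_sum[OF lin] sum_nonneg psd)
  qed
  have power_bound: "L ((c\<^sup>2) ^ n) \<le> N ^ n" for n
  proof (induction n)
    case (Suc n)
    have "L ((c\<^sup>2) ^ Suc n) = L (c\<^sup>2 * (c ^ n)\<^sup>2)" by (simp add: mult.commute flip: power_mult)
    also have "\<dots> \<le> N * L ((c\<^sup>2) ^ n)" using N[of "c ^ n"] by (simp add: mult.commute flip: power_mult)
    also have "\<dots> \<le> N * N ^ n" using Suc \<open>0 < N\<close> by (intro mult_left_mono) auto
    finally show ?case by simp
  qed (simp add: one)
  have "M ((c\<^sup>2) ^ (2 * n)) \<le> \<rho> * N ^ (2 * n)" for n
  proof -
    have "0 \<le> L ((c\<^sup>2) ^ (2 * n) * s)"
      using weighted_nonneg[of "(c\<^sup>2) ^ n"] by (simp add: mult.commute flip: power_mult)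
    then show ?thesis
      using mult_left_mono[OF power_bound[of "2 * n"] \<open>0 \<le> \<rho>\<close>] by (simp add: M_def)
  qed
  then have M_bound: "M (b\<^sup>2 * c\<^sup>2) \<le> N * M (b\<^sup>2)" for b
    using weighted_bound_of_moment_growth[OF M_lin M_psd \<open>0 < N\<close>] by blast
  define Q where "Q y = N * L y - L (c\<^sup>2 * y)" for y
  have "linear Q"
    by (intro linearI) (simp_all add: Q_def algebra_simps linear_add[OF lin] linear_scale[OF lin])
  moreover have "pos_semidef Q" using N by (simp add: Q_def pos_semidef_def)
  moreover have "Q (b\<^sup>2 * s) \<le> \<rho> * Q (b\<^sup>2)" for b
    using M_bound[of b] by (simp add: M_def Q_def algebra_simps)
  moreover have "0 < Q 1" using assms by (simp add: Q_def one)
  ultimately have "(\<lambda>y. Q y / Q 1) \<in> ball_states s \<rho>" by (rule ball_states_normalize)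
  then show "(\<lambda>y. (N * L y - L (c\<^sup>2 * y)) / (N - L (c\<^sup>2))) \<in> ball_states s \<rho>"
    by (simp add: Q_def one)
qed

text \<open>
  Multiplicativity against the generators propagates to the whole algebra, and squares suffice for
  the other factor because \<open>4 * x = (x + 1)\<^sup>2 - (x - 1)\<^sup>2\<close>.
\<close>

lemma multiplicative_of_squares:
  fixes L :: "'a::{comm_ring_1,real_algebra_1} \<Rightarrow> real"
  assumes gen: "generates_algebra G" and lin: "linear L" and one: "L 1 = 1"
    and sq: "\<And>c g. g \<in> G \<Longrightarrow> L (c\<^sup>2 * g) = L (c\<^sup>2) * L g"
  shows "L (x * y) = L x * L y"
  using gen
proof (induction y arbitrary: x rule: generates_algebra_induct)
  case (generator g)
  have polarize: "4 *\<^sub>R (x * z) = (x + 1)\<^sup>2 * z - (x - 1)\<^sup>2 * z" for z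
  proof -
    have "4 *\<^sub>R (x * z) = 2 *\<^sub>R (2 *\<^sub>R (x * z))" by simp
    then show ?thesis unfolding scaleR_2 by (simp add: power2_eq_square algebra_simps)
  qed
  then have polar: "4 * L (x * z) = L ((x + 1)\<^sup>2 * z) - L ((x - 1)\<^sup>2 * z)" for z
  proof -
    have "L (4 *\<^sub>R (x * z)) = L ((x + 1)\<^sup>2 * z - (x - 1)\<^sup>2 * z)"
      using polarize[of z] by (rule arg_cong)
    then show ?thesis by (simp only: linear_diff[OF lin] linear_scale[OF lin] real_scaleR_def)
  qed
  have "4 * L (x * g) = (L ((x + 1)\<^sup>2) - L ((x - 1)\<^sup>2)) * L g"
    unfolding polar by (simp add: sq generator left_diff_distrib)
  also have "\<dots> = 4 * (L x * L g)" using polar[of 1] by simp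
  finally show ?case by simp
next
  case (mult y z)
  have "L (x * (y * z)) = L (x * y) * L z" using mult(2)[of "x * y"] by (simp add: mult.assoc)
  then show ?case using mult by (simp add: mult.assoc)
qed (simp_all add: linear_0[OF lin] one distrib_left linear_add[OF lin] linear_scale[OF lin])

text \<open>
  The argument of the Krein--Milman theorem for the single element \<open>x\<close>. The minimizers of the value at \<open>x\<close> form a face of
  the compact convex set of states. On this face the function \<open>M \<mapsto> (\<Sum>i\<in>I. (M (a i))\<^sup>2)\<close> attains a
  maximum at some \<open>L1\<close>. It is strictly convex in the values at the generators, so the two parts into
  which \<open>ball_states_split\<close> decomposes \<open>L1\<close> agree with \<open>L1\<close> on the generators; where \<open>L1\<close> vanishes at
  \<open>c\<^sup>2\<close>, the Cauchy--Schwarz inequality replaces the decomposition. This makes \<open>L1\<close> a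
  character, and \<open>L x \<ge> L1 x \<ge> 0\<close>.
\<close>

lemma nonneg_of_nonneg_on_ball_characters:
  fixes a :: "'i \<Rightarrow> 'a::{comm_ring_1,real_algebra_1}"
  assumes gen: "generates_algebra (a ` I)" and "finite I" and s: "s = (\<Sum>i\<in>I. (a i)\<^sup>2)" and "0 \<le> \<rho>"
    and L: "L \<in> ball_states s \<rho>" and nonneg: "\<And>\<alpha>. \<alpha> \<in> ball_characters s \<rho> \<Longrightarrow> 0 \<le> \<alpha> x"
  shows "0 \<le> L x"
proof -
  let ?C = "ball_states s \<rho>"
  have compact: "compact ?C" by (rule compact_ball_states[OF gen \<open>finite I\<close> s \<open>0 \<le> \<rho>\<close>])
  have eval: "continuous_on S (\<lambda>f. f z)" for S :: "('a \<Rightarrow> real) set" and z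
    by (rule continuous_on_subset[OF continuous_on_product_coordinates]) simp
  have "\<exists>M\<in>?C. \<forall>M'\<in>?C. M x \<le> M' x"
    using L by (intro continuous_attains_inf[OF compact _ eval]) auto
  then obtain L0 where "L0 \<in> ?C" and min: "\<And>M. M \<in> ?C \<Longrightarrow> L0 x \<le> M x" by blast
  define F where "F = ?C \<inter> {M. M x \<le> L0 x}"
  have F: "compact F" unfolding F_def
    by (intro compact_Int_closed compact closed_Collect_le continuous_on_const) (rule eval)
  have "F \<noteq> {}" using \<open>L0 \<in> ?C\<close> by (auto simp: F_def)
  moreover have "continuous_on F (\<lambda>M. \<Sum>i\<in>I. (M (a i))\<^sup>2)"
    by (intro continuous_on_sum continuous_on_power eval)
  ultimately have "\<exists>M\<in>F. \<forall>M'\<in>F. (\<Sum>i\<in>I. (M' (a i))\<^sup>2) \<le> (\<Sum>i\<in>I. (M (a i))\<^sup>2)"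
    by (rule continuous_attains_sup[OF F])
  then obtain L1 where "L1 \<in> F"
    and max: "\<And>M. M \<in> F \<Longrightarrow> (\<Sum>i\<in>I. (M (a i))\<^sup>2) \<le> (\<Sum>i\<in>I. (L1 (a i))\<^sup>2)"
    by (elim bexE) (rule that, auto)
  have L1: "L1 \<in> ?C" and L1x: "L1 x = L0 x" using \<open>L1 \<in> F\<close> min[of L1] by (auto simp: F_def)
  have lin: "linear L1" and one: "L1 1 = 1" and psd: "pos_semidef L1"
    using L1 by (auto simp: ball_states_def)
  have sq: "L1 (c\<^sup>2 * a i) = L1 (c\<^sup>2) * L1 (a i)" if i: "i \<in> I" for c i
  proof (cases "L1 (c\<^sup>2) = 0")
    case True
    have "(L1 (c * (c * a i)))\<^sup>2 \<le> L1 (c\<^sup>2) * L1 ((c * a i)\<^sup>2)"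
      by (rule Cauchy_Schwarz_pos_semidef[OF lin psd])
    then have "L1 (c * (c * a i)) = 0" using True by simp
    then show ?thesis using True by (simp add: power2_eq_square mult.assoc)
  next
    case False
    then have pos: "0 < L1 (c\<^sup>2)" using psd by (simp add: pos_semidef_def order_less_le)
    obtain N0 where N0: "\<And>b. L1 (c\<^sup>2 * b\<^sup>2) \<le> N0 * L1 (b\<^sup>2)"
      using ball_states_uniform_bound[OF gen \<open>finite I\<close> s \<open>0 \<le> \<rho>\<close>] L1 by blast
    \<comment> \<open>a strict bound, so that both parts of the decomposition have positive weight\<close>
    define N where "N = N0 + 1"
    have N: "L1 (c\<^sup>2 * b\<^sup>2) \<le> N * L1 (b\<^sup>2)" for b
      using N0[of b] psd by (simp add: N_def distrib_right pos_semidef_def add_increasing2)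
    have less: "L1 (c\<^sup>2) < N" using N0[of 1] by (simp add: N_def one)
    define \<theta> where "\<theta> = L1 (c\<^sup>2) / N"
    define P where "P y = L1 (c\<^sup>2 * y) / L1 (c\<^sup>2)" for y
    define Q where "Q y = (N * L1 y - L1 (c\<^sup>2 * y)) / (N - L1 (c\<^sup>2))" for y
    have "P \<in> ?C" "Q \<in> ?C"
      using ball_states_split[OF L1 s \<open>0 \<le> \<rho>\<close> N less pos]
      by (simp_all add: P_def[abs_def] Q_def[abs_def])
    have \<theta>: "0 < \<theta>" "\<theta> < 1" using pos less by (auto simp: \<theta>_def)
    have convex: "L1 y = \<theta> * P y + (1 - \<theta>) * Q y" for y
    proof -
      have "\<theta> * P y = L1 (c\<^sup>2 * y) / N" using pos by (simp add: \<theta>_def P_def)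
      moreover have "(1 - \<theta>) * Q y = (N * L1 y - L1 (c\<^sup>2 * y)) / N"
      proof -
        have "1 - \<theta> = (N - L1 (c\<^sup>2)) / N" using pos less by (simp add: \<theta>_def field_simps)
        then show ?thesis using less by (simp add: Q_def)
      qed
      ultimately show ?thesis using pos less by (simp add: diff_divide_distrib)
    qed
    \<comment> \<open>both parts stay in the face of minimizers\<close>
    have "P x = L0 x \<and> Q x = L0 x"
    proof -
      have "0 \<le> P x - L0 x" "0 \<le> Q x - L0 x" using min \<open>P \<in> ?C\<close> \<open>Q \<in> ?C\<close> by auto
      moreover have "\<theta> * (P x - L0 x) + (1 - \<theta>) * (Q x - L0 x) = 0"
        using convex[of x] L1x by (simp add: algebra_simps)
      ultimately show ?thesis using \<theta>
        by (simp add: add_nonneg_eq_0_iff)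
    qed
    then have "P \<in> F" "Q \<in> F" using \<open>P \<in> ?C\<close> \<open>Q \<in> ?C\<close> by (auto simp: F_def)
    have "(\<Sum>i\<in>I. (L1 (a i))\<^sup>2) = (\<Sum>i\<in>I. \<theta> * (P (a i))\<^sup>2 + (1 - \<theta>) * (Q (a i))\<^sup>2
        - \<theta> * (1 - \<theta>) * (P (a i) - Q (a i))\<^sup>2)"
    proof (intro sum.cong refl)
      fix i
      have "(\<theta> * p + (1 - \<theta>) * q)\<^sup>2 = \<theta> * p\<^sup>2 + (1 - \<theta>) * q\<^sup>2 - \<theta> * (1 - \<theta>) * (p - q)\<^sup>2" for p q
        by (simp add: power2_eq_square algebra_simps)
      then show "(L1 (a i))\<^sup>2 = \<theta> * (P (a i))\<^sup>2 + (1 - \<theta>) * (Q (a i))\<^sup>2 - \<theta> * (1 - \<theta>) * (P (a i) - Q (a i))\<^sup>2"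
        using convex[of "a i"] by simp
    qed
    also have "\<dots> = \<theta> * (\<Sum>i\<in>I. (P (a i))\<^sup>2) + (1 - \<theta>) * (\<Sum>i\<in>I. (Q (a i))\<^sup>2)
        - \<theta> * (1 - \<theta>) * (\<Sum>i\<in>I. (P (a i) - Q (a i))\<^sup>2)"
      by (simp add: sum.distrib sum_subtractf sum_distrib_left)
    also have "\<dots> \<le> \<theta> * (\<Sum>i\<in>I. (L1 (a i))\<^sup>2) + (1 - \<theta>) * (\<Sum>i\<in>I. (L1 (a i))\<^sup>2)
        - \<theta> * (1 - \<theta>) * (\<Sum>i\<in>I. (P (a i) - Q (a i))\<^sup>2)"
      using max[OF \<open>P \<in> F\<close>] max[OF \<open>Q \<in> F\<close>] \<theta>
      by (intro diff_right_mono add_mono mult_left_mono) simp_all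
    also have "\<dots> = (\<Sum>i\<in>I. (L1 (a i))\<^sup>2) - \<theta> * (1 - \<theta>) * (\<Sum>i\<in>I. (P (a i) - Q (a i))\<^sup>2)"
      by (simp only: distrib_right[symmetric]) simp
    finally have "\<theta> * (1 - \<theta>) * (\<Sum>i\<in>I. (P (a i) - Q (a i))\<^sup>2) \<le> 0"
      by simp
    then have "(\<Sum>i\<in>I. (P (a i) - Q (a i))\<^sup>2) \<le> 0"
      using \<theta> by (simp add: mult_le_0_iff)
    moreover have "(P (a i) - Q (a i))\<^sup>2 \<le> (\<Sum>i\<in>I. (P (a i) - Q (a i))\<^sup>2)"
      using \<open>finite I\<close> by (intro member_le_sum[OF i]) auto
    ultimately have "(P (a i) - Q (a i))\<^sup>2 \<le> 0" by linarith
    then have "P (a i) = Q (a i)" by simp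
    then have "P (a i) = L1 (a i)" using convex[of "a i"] by (simp add: algebra_simps)
    then show ?thesis using pos by (simp add: P_def field_simps)
  qed
  have "L1 (y * z) = L1 y * L1 z" for y z
    by (rule multiplicative_of_squares[OF gen lin one]) (auto simp: sq)
  then have "L1 \<in> ball_characters s \<rho>" using L1 by (simp add: ball_characters_eq)
  then show ?thesis using nonneg[of L1] L1x min[OF L] by simp
qed

section \<open>Riesz representation from a dense space of continuous functions\<close>

text \<open>
  \<open>H n\<close> is the first level \<open>t k\<close> that is at least \<open>v\<close>, written as a sum of increments so that as a function
  of \<open>v\<close> it becomes a linear combination of indicators of sets \<open>{f > t k}\<close>.
\<close>

lemma staircase_approximation:
  fixes t :: "nat \<Rightarrow> real"
  assumes step: "\<And>k. t k \<le> t (Suc k)" "\<And>k. t (Suc k) \<le> t k + d" and v: "t 0 < v" "v \<le> t n"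
  defines "H \<equiv> \<lambda>n. t 0 + (\<Sum>k<n. (t (Suc k) - t k) * (if t k < v then 1 else 0))"
  shows "v \<le> H n \<and> H n \<le> v + d"
proof -
  have "min v (t n) \<le> H n \<and> H n \<le> min (v + d) (t n)"
  proof (induction n)
    case 0
    have "0 \<le> d" using step(1)[of 0] step(2)[of 0] by simp
    then show ?case using v(1) by (simp add: H_def)
  next
    case (Suc n)
    then show ?case using step(1)[of n] step(2)[of n] by (auto simp: H_def min_def split: if_splits)
  qed
  then show ?thesis using v(2) by simp
qed

text \<open>
  The setting of the representation theorem. The functions \<open>ev x\<close> stand for a dense space of continuous
  functions on the compact space \<open>X\<close>; they are indexed by elements \<open>x\<close> of a vector space so that \<open>L\<close> can
  be a functional on an algebra rather than on its image among the functions. The last assumption,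
  that closed sets are zero sets, holds when \<open>X\<close> is metrizable.
\<close>

locale dense_positive_functional =
  fixes X :: "'b::t2_space set" and ev :: "'a::real_vector \<Rightarrow> 'b \<Rightarrow> real"
    and L :: "'a \<Rightarrow> real" and e :: 'a
  assumes compact: "compact X"
    and ev_linear: "p \<in> X \<Longrightarrow> linear (\<lambda>x. ev x p)"
    and ev_continuous: "continuous_on X (ev x)"
    and ev_unit: "p \<in> X \<Longrightarrow> ev e p = 1"
    and L_linear: "linear L"
    and L_nonneg: "(\<And>p. p \<in> X \<Longrightarrow> 0 \<le> ev x p) \<Longrightarrow> 0 \<le> L x"
    and dense: "continuous_on X f \<Longrightarrow> 0 < \<epsilon> \<Longrightarrow> \<exists>x. \<forall>p\<in>X. \<bar>f p - ev x p\<bar> < \<epsilon>"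
    and zero_sets: "closed C \<Longrightarrow> \<exists>f :: 'b \<Rightarrow> real. continuous_on X f \<and> (\<forall>p\<in>X. 0 \<le> f p \<and> (f p = 0 \<longleftrightarrow> p \<in> C))"
begin

lemmas ev_simps = linear_add[OF ev_linear] linear_diff[OF ev_linear] linear_scale[OF ev_linear]
  linear_neg[OF ev_linear] ev_unit
lemmas L_simps = linear_add[OF L_linear] linear_diff[OF L_linear] linear_scale[OF L_linear]
  linear_neg[OF L_linear]

lemma L_mono: "(\<And>p. p \<in> X \<Longrightarrow> ev x p \<le> ev y p) \<Longrightarrow> L x \<le> L y"
  using L_nonneg[of "y - x"] by (simp add: ev_simps L_simps)

lemma L_unit_nonneg: "0 \<le> L e"
  by (rule L_nonneg) (simp add: ev_unit)

text \<open>
  Riemann integrability relative to \<open>L\<close>, with \<open>c\<close> as the integral: \<open>f\<close> is squeezed between two functions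
  of the dense space on which \<open>L\<close> takes almost the same value. The \<open>\<epsilon>\<close> bounds the distance of these
  values from \<open>c\<close>, which lets sums be estimated without suprema and infima.
\<close>

definition has_mean :: "('b \<Rightarrow> real) \<Rightarrow> real \<Rightarrow> bool" where
  "has_mean f c \<longleftrightarrow> (\<forall>\<epsilon>>0. \<exists>x y. (\<forall>p\<in>X. ev x p \<le> f p \<and> f p \<le> ev y p) \<and> c - \<epsilon> \<le> L x \<and> L y \<le> c + \<epsilon>)"

lemma has_meanE:
  assumes "has_mean f c" "0 < \<epsilon>"
  obtains x y where "\<And>p. p \<in> X \<Longrightarrow> ev x p \<le> f p" "\<And>p. p \<in> X \<Longrightarrow> f p \<le> ev y p"
    "c - \<epsilon> \<le> L x" "L y \<le> c + \<epsilon>"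
  using assms unfolding has_mean_def by meson

lemma has_mean_ev: "has_mean (ev x) (L x)"
  unfolding has_mean_def by (intro allI impI exI[of _ x]) auto

lemma has_mean_cong: "has_mean f c \<Longrightarrow> (\<And>p. p \<in> X \<Longrightarrow> f p = g p) \<Longrightarrow> has_mean g c"
  unfolding has_mean_def by simp

lemma has_mean_const: "has_mean (\<lambda>_. k) (k * L e)"
  using has_mean_cong[OF has_mean_ev[of "k *\<^sub>R e"], of "\<lambda>_. k"] by (simp add: ev_simps L_simps)

lemma has_mean_mono:
  assumes f: "has_mean f c" and g: "has_mean g d" and le: "\<And>p. p \<in> X \<Longrightarrow> f p \<le> g p"
  shows "c \<le> d"
proof (rule field_le_epsilon)
  fix \<epsilon> :: real assume "0 < \<epsilon>"
  then have "0 < \<epsilon> / 2" by simp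
  obtain x where x: "\<And>p. p \<in> X \<Longrightarrow> ev x p \<le> f p" "c - \<epsilon> / 2 \<le> L x"
    using has_meanE[OF f \<open>0 < \<epsilon> / 2\<close>] by metis
  obtain y where y: "\<And>p. p \<in> X \<Longrightarrow> g p \<le> ev y p" "L y \<le> d + \<epsilon> / 2"
    using has_meanE[OF g \<open>0 < \<epsilon> / 2\<close>] by metis
  have "L x \<le> L y" by (rule L_mono) (meson x(1) y(1) le order_trans)
  then show "c \<le> d + \<epsilon>" using x(2) y(2) by simp
qed

lemma has_mean_unique: "has_mean f c \<Longrightarrow> has_mean f d \<Longrightarrow> c = d"
  by (rule antisym) (erule (1) has_mean_mono, simp)+

lemma has_mean_add:
  assumes f: "has_mean f c" and g: "has_mean g d"
  shows "has_mean (\<lambda>p. f p + g p) (c + d)"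
  unfolding has_mean_def
proof (intro allI impI)
  fix \<epsilon> :: real assume "0 < \<epsilon>"
  then have "0 < \<epsilon> / 2" by simp
  obtain x y where x: "\<And>p. p \<in> X \<Longrightarrow> ev x p \<le> f p" "\<And>p. p \<in> X \<Longrightarrow> f p \<le> ev y p"
    "c - \<epsilon> / 2 \<le> L x" "L y \<le> c + \<epsilon> / 2"
    using has_meanE[OF f \<open>0 < \<epsilon> / 2\<close>] by metis
  obtain x' y' where y: "\<And>p. p \<in> X \<Longrightarrow> ev x' p \<le> g p" "\<And>p. p \<in> X \<Longrightarrow> g p \<le> ev y' p"
    "d - \<epsilon> / 2 \<le> L x'" "L y' \<le> d + \<epsilon> / 2"
    using has_meanE[OF g \<open>0 < \<epsilon> / 2\<close>] by metis
  show "\<exists>x y. (\<forall>p\<in>X. ev x p \<le> f p + g p \<and> f p + g p \<le> ev y p) \<and> c + d - \<epsilon> \<le> L x \<and> L y \<le> c + d + \<epsilon>"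
    using x y by (intro exI[of _ "x + x'"] exI[of _ "y + y'"]) (auto simp: ev_simps L_simps intro: add_mono)
qed

lemma has_mean_uminus:
  assumes f: "has_mean f c"
  shows "has_mean (\<lambda>p. - f p) (- c)"
  unfolding has_mean_def
proof (intro allI impI)
  fix \<epsilon> :: real assume "0 < \<epsilon>"
  obtain x y where x: "\<And>p. p \<in> X \<Longrightarrow> ev x p \<le> f p" "\<And>p. p \<in> X \<Longrightarrow> f p \<le> ev y p"
    "c - \<epsilon> \<le> L x" "L y \<le> c + \<epsilon>"
    using has_meanE[OF f \<open>0 < \<epsilon>\<close>] by metis
  show "\<exists>x y. (\<forall>p\<in>X. ev x p \<le> - f p \<and> - f p \<le> ev y p) \<and> - c - \<epsilon> \<le> L x \<and> L y \<le> - c + \<epsilon>"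
    using x by (intro exI[of _ "- y"] exI[of _ "- x"]) (auto simp: ev_simps L_simps)
qed

lemma has_mean_diff:
  "has_mean f c \<Longrightarrow> has_mean g d \<Longrightarrow> has_mean (\<lambda>p. f p - g p) (c - d)"
  using has_mean_add[OF _ has_mean_uminus, of f c g d] by simp

lemma has_mean_scale_nonneg:
  assumes f: "has_mean f c" and "0 \<le> k"
  shows "has_mean (\<lambda>p. k * f p) (k * c)"
  unfolding has_mean_def
proof (intro allI impI)
  fix \<epsilon> :: real assume "0 < \<epsilon>"
  then have pos: "0 < \<epsilon> / (k + 1)" using \<open>0 \<le> k\<close> by simp
  obtain x y where x: "\<And>p. p \<in> X \<Longrightarrow> ev x p \<le> f p" "\<And>p. p \<in> X \<Longrightarrow> f p \<le> ev y p"
    "c - \<epsilon> / (k + 1) \<le> L x" "L y \<le> c + \<epsilon> / (k + 1)"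
    using has_meanE[OF f pos] by metis
  have "k * (\<epsilon> / (k + 1)) \<le> \<epsilon>" using \<open>0 < \<epsilon>\<close> \<open>0 \<le> k\<close> by (simp add: divide_le_eq distrib_left)
  moreover have "k * (c - \<epsilon> / (k + 1)) \<le> k * L x" "k * L y \<le> k * (c + \<epsilon> / (k + 1))"
    using x \<open>0 \<le> k\<close> by (auto intro: mult_left_mono)
  ultimately have "k * c - \<epsilon> \<le> k * L x" "k * L y \<le> k * c + \<epsilon>"
    unfolding right_diff_distrib distrib_left by linarith+
  then show "\<exists>x y. (\<forall>p\<in>X. ev x p \<le> k * f p \<and> k * f p \<le> ev y p) \<and> k * c - \<epsilon> \<le> L x \<and> L y \<le> k * c + \<epsilon>"
    using x \<open>0 \<le> k\<close>
    by (intro exI[of _ "k *\<^sub>R x"] exI[of _ "k *\<^sub>R y"]) (auto simp: ev_simps L_simps intro: mult_left_mono)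
qed

lemma has_mean_sum:
  assumes "finite I" "\<And>i. i \<in> I \<Longrightarrow> has_mean (f i) (c i)"
  shows "has_mean (\<lambda>p. \<Sum>i\<in>I. f i p) (\<Sum>i\<in>I. c i)"
  using assms
proof (induction I rule: finite_induct)
  case empty
  show ?case using has_mean_const[of 0] by simp
next
  case (insert i I)
  then show ?case using has_mean_add[of "f i" "c i" "\<lambda>p. \<Sum>i\<in>I. f i p" "\<Sum>i\<in>I. c i"] by simp
qed

text \<open>
  Completeness of the reals supplies the integral: it is the supremum of the integrals of the
  integrable functions below \<open>f\<close>.
\<close>

lemma has_mean_sandwich:
  assumes "\<And>\<epsilon>. 0 < \<epsilon> \<Longrightarrow> \<exists>g h c d. has_mean g c \<and> has_mean h d \<and> (\<forall>p\<in>X. g p \<le> f p \<and> f p \<le> h p) \<and> d - c \<le> \<epsilon>"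
  shows "\<exists>c. has_mean f c"
proof -
  define S where "S = {c. \<exists>g. has_mean g c \<and> (\<forall>p\<in>X. g p \<le> f p)}"
  have upper: "c \<le> d" if "c \<in> S" "has_mean h d" "\<forall>p\<in>X. f p \<le> h p" for c d h
  proof -
    from \<open>c \<in> S\<close> obtain g where "has_mean g c" "\<forall>p\<in>X. g p \<le> f p" by (auto simp: S_def)
    then show ?thesis using that by (intro has_mean_mono[of g c h d]) (auto intro: order_trans)
  qed
  obtain g0 h0 c0 d0 where 0: "has_mean g0 c0" "has_mean h0 d0" "\<forall>p\<in>X. g0 p \<le> f p \<and> f p \<le> h0 p"
    using assms[of 1] by auto
  have "S \<noteq> {}" using 0 by (auto simp: S_def)
  have bdd: "bdd_above S" using upper[OF _ 0(2)] 0(3) by (intro bdd_aboveI[of _ d0]) auto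
  have "has_mean f (Sup S)"
    unfolding has_mean_def
  proof (intro allI impI)
    fix \<epsilon> :: real assume "0 < \<epsilon>"
    then have "0 < \<epsilon> / 2" by simp
    obtain g h c d where gh: "has_mean g c" "has_mean h d" "\<forall>p\<in>X. g p \<le> f p \<and> f p \<le> h p" "d - c \<le> \<epsilon> / 2"
      using assms[OF \<open>0 < \<epsilon> / 2\<close>] by auto
    have "c \<le> Sup S" using gh by (intro cSup_upper bdd) (auto simp: S_def)
    moreover have "Sup S \<le> d" using upper[OF _ gh(2)] gh(3) by (intro cSup_least \<open>S \<noteq> {}\<close>) auto
    moreover obtain x where "\<And>p. p \<in> X \<Longrightarrow> ev x p \<le> g p" "c - \<epsilon> / 2 \<le> L x"
      using has_meanE[OF gh(1) \<open>0 < \<epsilon> / 2\<close>] by metis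
    moreover obtain y where "\<And>p. p \<in> X \<Longrightarrow> h p \<le> ev y p" "L y \<le> d + \<epsilon> / 2"
      using has_meanE[OF gh(2) \<open>0 < \<epsilon> / 2\<close>] by metis
    ultimately show "\<exists>x y. (\<forall>p\<in>X. ev x p \<le> f p \<and> f p \<le> ev y p) \<and> Sup S - \<epsilon> \<le> L x \<and> L y \<le> Sup S + \<epsilon>"
      using gh(3,4) by (intro exI[of _ x] exI[of _ y]) (auto intro: order_trans)
  qed
  then show ?thesis ..
qed

lemma has_mean_continuous:
  assumes "continuous_on X f"
  shows "\<exists>c. has_mean f c"
proof (rule has_mean_sandwich)
  fix \<epsilon> :: real assume "0 < \<epsilon>"
  define \<delta> where "\<delta> = \<epsilon> / (2 * (L e + 1))"
  have "0 < \<delta>" using \<open>0 < \<epsilon>\<close> L_unit_nonneg by (simp add: \<delta>_def)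
  obtain x where x: "\<forall>p\<in>X. \<bar>f p - ev x p\<bar> < \<delta>" using dense[OF assms \<open>0 < \<delta>\<close>] by blast
  have "L (x + \<delta> *\<^sub>R e) - L (x - \<delta> *\<^sub>R e) = (2 * \<delta>) * L e"
    by (simp add: L_simps)
  also have "2 * \<delta> = \<epsilon> / (L e + 1)" using L_unit_nonneg by (simp add: \<delta>_def field_simps)
  also have "\<epsilon> / (L e + 1) * L e \<le> \<epsilon>" using \<open>0 < \<epsilon>\<close> L_unit_nonneg by (simp add: field_simps)
  finally have "L (x + \<delta> *\<^sub>R e) - L (x - \<delta> *\<^sub>R e) \<le> \<epsilon>" .
  moreover have "\<forall>p\<in>X. ev (x - \<delta> *\<^sub>R e) p \<le> f p \<and> f p \<le> ev (x + \<delta> *\<^sub>R e) p"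
    using x by (force simp: ev_simps abs_less_iff)
  ultimately show "\<exists>g h c d. has_mean g c \<and> has_mean h d \<and> (\<forall>p\<in>X. g p \<le> f p \<and> f p \<le> h p) \<and> d - c \<le> \<epsilon>"
    using has_mean_ev by blast
qed

text \<open>
  Taking the positive part does not increase the gap between the lower and the upper function, and it
  keeps them continuous. Together with linearity this makes the integrable functions a vector
  lattice, hence the sets with integrable indicator an algebra of sets.
\<close>

lemma has_mean_positive_part:
  assumes f: "has_mean f c"
  shows "\<exists>d. has_mean (\<lambda>p. max (f p) 0) d"
proof (rule has_mean_sandwich)
  fix \<epsilon> :: real assume "0 < \<epsilon>"
  then have "0 < \<epsilon> / 2" by simp
  obtain x y where x: "\<And>p. p \<in> X \<Longrightarrow> ev x p \<le> f p" "\<And>p. p \<in> X \<Longrightarrow> f p \<le> ev y p"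
    "c - \<epsilon> / 2 \<le> L x" "L y \<le> c + \<epsilon> / 2"
    using has_meanE[OF f \<open>0 < \<epsilon> / 2\<close>] by metis
  have "\<exists>d. has_mean (\<lambda>p. max (ev z p) 0) d" for z
    by (intro has_mean_continuous continuous_on_max ev_continuous continuous_on_const)
  then obtain d d' where d: "has_mean (\<lambda>p. max (ev x p) 0) d" "has_mean (\<lambda>p. max (ev y p) 0) d'"
    by blast
  have "d' - d \<le> L y - L x"
  proof (rule has_mean_mono[OF has_mean_diff[OF d(2,1)] has_mean_diff[OF has_mean_ev has_mean_ev]])
    fix p assume "p \<in> X"
    then have "ev x p \<le> ev y p" using x(1,2)[of p] by simp
    then show "max (ev y p) 0 - max (ev x p) 0 \<le> ev y p - ev x p" by (simp add: max_def)
  qed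
  then have "d' - d \<le> \<epsilon>" using x by simp
  moreover have "\<forall>p\<in>X. max (ev x p) 0 \<le> max (f p) 0 \<and> max (f p) 0 \<le> max (ev y p) 0"
    using x(1,2) by (intro ballI conjI max.mono) auto
  ultimately show "\<exists>g h c d. has_mean g c \<and> has_mean h d \<and> (\<forall>p\<in>X. g p \<le> max (f p) 0 \<and> max (f p) 0 \<le> h p) \<and> d - c \<le> \<epsilon>"
    using d by blast
qed

definition mean :: "('b \<Rightarrow> real) \<Rightarrow> real" where
  "mean f = (THE c. has_mean f c)"

lemma mean_eq: "has_mean f c \<Longrightarrow> mean f = c"
  unfolding mean_def by (rule the_equality) (auto intro: has_mean_unique)

text \<open>
  The analogue of the Jordan measurable sets, on which \<open>L\<close> determines a finitely additive measure.
\<close>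

definition jordan_sets :: "'b set set" where
  "jordan_sets = {E. E \<subseteq> X \<and> (\<exists>c. has_mean (indicator E) c)}"

lemma has_mean_jordan: "E \<in> jordan_sets \<Longrightarrow> has_mean (indicator E) (mean (indicator E))"
  by (auto simp: jordan_sets_def mean_eq)

lemma jordan_empty: "{} \<in> jordan_sets"
  using has_mean_cong[OF has_mean_const[of 0], of "indicator {}"] by (auto simp: jordan_sets_def)

lemma has_mean_indicator_space: "has_mean (indicator X) (L e)"
  using has_mean_cong[OF has_mean_const[of 1], of "indicator X"] by simp

lemma jordan_space: "X \<in> jordan_sets"
  using has_mean_indicator_space by (auto simp: jordan_sets_def)

lemma jordan_diff:
  assumes "E \<in> jordan_sets" "F \<in> jordan_sets"
  shows "E - F \<in> jordan_sets"
proof -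
  obtain c where "has_mean (\<lambda>p. max (indicator E p - indicator F p) 0) c"
    using has_mean_positive_part[OF has_mean_diff[OF assms[THEN has_mean_jordan]]] by blast
  then have "has_mean (indicator (E - F)) c"
    by (rule has_mean_cong) (auto simp: indicator_def)
  then show ?thesis using assms by (auto simp: jordan_sets_def)
qed

lemma jordan_Un:
  assumes "E \<in> jordan_sets" "F \<in> jordan_sets"
  shows "E \<union> F \<in> jordan_sets"
proof -
  have "E \<union> F = X - ((X - E) - F)" using assms by (auto simp: jordan_sets_def)
  then show ?thesis using assms by (simp add: jordan_diff jordan_space)
qed

lemma ring_of_sets_jordan: "ring_of_sets X jordan_sets"
  using jordan_empty jordan_Un jordan_diff by (auto simp: ring_of_sets_iff jordan_sets_def)

lemma mean_indicator_nonneg: "E \<in> jordan_sets \<Longrightarrow> 0 \<le> mean (indicator E)"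
  using has_mean_mono[OF has_mean_const[of 0] has_mean_jordan, of E] by simp

lemma mean_indicator_Un:
  assumes "E \<in> jordan_sets" "F \<in> jordan_sets" "E \<inter> F = {}"
  shows "mean (indicator (E \<union> F)) = mean (indicator E) + mean (indicator F)"
  by (intro mean_eq has_mean_cong[OF has_mean_add[OF assms(1,2)[THEN has_mean_jordan]]])
    (use assms(3) in \<open>auto simp: indicator_def\<close>)

text \<open>
  Continuity at the empty set; compactness of \<open>X\<close> replaces countable additivity here. Choose \<open>x i\<close> with \<open>ev (x i)\<close> below
  the indicator of \<open>A i\<close> and with value short of the measure of \<open>A i\<close> by at most \<open>\<eta> / 2 ^ (i + 1)\<close>. The closed
  sets on which \<open>ev (x i) \<ge> \<eta>\<close> have empty intersection, so finitely many of them do, and then the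
  indicator of \<open>A m\<close> is at most \<open>\<eta>\<close> plus finitely many of the differences.
\<close>

lemma mean_decseq_tendsto_0:
  assumes A: "range A \<subseteq> jordan_sets" and "decseq A" and "(\<Inter>i. A i) = {}"
  shows "(\<lambda>i. mean (indicator (A i))) \<longlonglongrightarrow> 0"
proof -
  have A': "A i \<in> jordan_sets" for i using A by auto
  have small: "\<exists>n. \<forall>m\<ge>n. mean (indicator (A m)) \<le> \<eta> * (L e + 1)" if "0 < \<eta>" for \<eta>
  proof -
    have "\<exists>x. (\<forall>p\<in>X. ev x p \<le> indicator (A i) p) \<and> mean (indicator (A i)) - \<eta> * (1/2) ^ Suc i \<le> L x" for i
    proof -
      have "0 < \<eta> * (1/2) ^ Suc i" using \<open>0 < \<eta>\<close> by simp
      then show ?thesis using has_meanE[OF has_mean_jordan[OF A'[of i]]] by metis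
    qed
    then obtain x where x: "\<And>i p. p \<in> X \<Longrightarrow> ev (x i) p \<le> indicator (A i) p"
      "\<And>i. mean (indicator (A i)) - \<eta> * (1/2) ^ Suc i \<le> L (x i)" by metis
    define F where "F n = {p\<in>X. \<forall>i\<in>{..n}. \<eta> \<le> ev (x i) p}" for n
    have closed: "closed (X \<inter> ev (x i) -` {\<eta>..})" for i
      using continuous_on_closed_vimage[OF compact_imp_closed[OF compact], of "ev (x i)"] ev_continuous
      by (auto simp: Int_commute)
    have "\<exists>n. F n = {}"
    proof (rule ccontr)
      assume "\<nexists>n. F n = {}"
      then have nonempty: "F n \<noteq> {}" for n by blast
      have "X \<inter> (\<Inter>i\<in>UNIV. X \<inter> ev (x i) -` {\<eta>..}) \<noteq> {}"
      proof (rule compact_imp_fip_image[OF compact closed])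
        fix I :: "nat set" assume "finite I"
        have "F (Max (insert 0 I)) \<subseteq> X \<inter> (\<Inter>i\<in>I. X \<inter> ev (x i) -` {\<eta>..})"
          using \<open>finite I\<close> by (auto simp: F_def)
        then show "X \<inter> (\<Inter>i\<in>I. X \<inter> ev (x i) -` {\<eta>..}) \<noteq> {}" using nonempty by blast
      qed
      then obtain p where p: "p \<in> X" "\<And>i. \<eta> \<le> ev (x i) p" by auto
      have "p \<in> A i" for i
      proof -
        have "0 < (indicator (A i) p :: real)"
          using p(2)[of i] x(1)[OF p(1), of i] \<open>0 < \<eta>\<close> by simp
        then show ?thesis by (auto simp: indicator_def split: if_splits)
      qed
      then show False using assms(3) by auto
    qed
    then obtain n where n: "F n = {}" by blast
    have "mean (indicator (A m)) \<le> \<eta> * (L e + 1)" if "n \<le> m" for m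
    proof -
      have "mean (indicator (A m)) \<le> \<eta> * L e + (\<Sum>i\<le>n. mean (indicator (A i)) - L (x i))"
      proof (rule has_mean_mono)
        show "has_mean (indicator (A m)) (mean (indicator (A m)))" by (rule has_mean_jordan[OF A'])
        show "has_mean (\<lambda>p. \<eta> + (\<Sum>i\<le>n. indicator (A i) p - ev (x i) p))
          (\<eta> * L e + (\<Sum>i\<le>n. mean (indicator (A i)) - L (x i)))"
          by (intro has_mean_add has_mean_const has_mean_sum has_mean_diff has_mean_ev has_mean_jordan A') simp
        fix p assume "p \<in> X"
        have nonneg: "0 \<le> indicator (A i) p - ev (x i) p" for i using x(1)[OF \<open>p \<in> X\<close>, of i] by simp
        show "indicator (A m) p \<le> \<eta> + (\<Sum>i\<le>n. indicator (A i) p - ev (x i) p)"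
        proof (cases "p \<in> A m")
          case True
          obtain i where i: "i \<le> n" "ev (x i) p < \<eta>"
            using n \<open>p \<in> X\<close> by (auto simp: F_def not_le)
          have "p \<in> A i" using True decseqD[OF \<open>decseq A\<close>, of i m] i \<open>n \<le> m\<close> by auto
          then have "1 \<le> \<eta> + (indicator (A i) p - ev (x i) p)" using i by simp
          also have "\<dots> \<le> \<eta> + (\<Sum>i\<le>n. indicator (A i) p - ev (x i) p)"
            using i nonneg by (intro add_left_mono member_le_sum) auto
          finally show ?thesis using True by simp
        next
          case False
          moreover have "0 \<le> (\<Sum>i\<le>n. indicator (A i) p - ev (x i) p)" by (rule sum_nonneg) (rule nonneg)
          ultimately show ?thesis using \<open>0 < \<eta>\<close> by simp
        qed
      qed
      also have "(\<Sum>i\<le>n. mean (indicator (A i)) - L (x i)) \<le> (\<Sum>i\<le>n. \<eta> * (1/2) ^ Suc i)"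
        using x(2) by (intro sum_mono) (simp only: diff_le_eq add.commute)
      also have "\<dots> = \<eta> * (\<Sum>i\<le>n. (1/2) ^ Suc i)" by (simp add: sum_distrib_left)
      also have "(\<Sum>i\<le>n. (1/2::real) ^ Suc i) \<le> 1"
      proof -
        have "(\<Sum>i\<le>n. (1/2::real) ^ Suc i) = 1 - (1/2) ^ Suc n" for n by (induction n) (simp_all add: field_simps)
        then show ?thesis by simp
      qed
      finally show ?thesis using \<open>0 < \<eta>\<close> by (simp add: algebra_simps)
    qed
    then show ?thesis by blast
  qed
  show ?thesis
  proof (rule LIMSEQ_I)
    fix r :: real assume "0 < r"
    define \<eta> where "\<eta> = r / (2 * (L e + 1))"
    have "0 < \<eta>" using \<open>0 < r\<close> L_unit_nonneg by (simp add: \<eta>_def)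
    have "\<eta> * (L e + 1) = r / 2"
      using L_unit_nonneg unfolding \<eta>_def by (simp add: divide_eq_eq eq_divide_eq)
    then have "\<eta> * (L e + 1) < r" using \<open>0 < r\<close> by simp
    then obtain n where "\<forall>m\<ge>n. mean (indicator (A m)) < r"
      using small[OF \<open>0 < \<eta>\<close>] by (meson le_less_trans)
    then show "\<exists>no. \<forall>n\<ge>no. norm (mean (indicator (A n)) - 0) < r"
      using mean_indicator_nonneg[OF A'] by auto
  qed
qed

lemma jordan_measure_exists:
  "\<exists>M. space M = X \<and> sets M = sigma_sets X jordan_sets \<and>
     (\<forall>E\<in>jordan_sets. emeasure M E = ennreal (mean (indicator E)))"
proof -
  interpret ring_of_sets X jordan_sets by (rule ring_of_sets_jordan)
  let ?f = "\<lambda>E. ennreal (mean (indicator E))"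
  have "mean (indicator {}) = 0"
    using has_mean_cong[OF has_mean_const[of 0], of "indicator {}"] by (intro mean_eq) simp
  then have "positive jordan_sets ?f" by (simp add: positive_def)
  moreover have "Measure_Space.additive jordan_sets ?f"
    by (auto simp: Measure_Space.additive_def mean_indicator_Un mean_indicator_nonneg)
  moreover have "(\<lambda>i. ?f (A i)) \<longlonglongrightarrow> 0"
    if "range A \<subseteq> jordan_sets" "decseq A" "(\<Inter>i. A i) = {}" for A
    using tendsto_ennrealI[OF mean_decseq_tendsto_0[OF that]] by simp
  ultimately obtain \<mu> where \<mu>: "\<And>E. E \<in> jordan_sets \<Longrightarrow> \<mu> E = ?f E"
    and ms: "measure_space X (sigma_sets X jordan_sets) \<mu>"
    using caratheodory_empty_continuous[of ?f] by auto
  let ?M = "measure_of X (sigma_sets X jordan_sets) \<mu>"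
  have "emeasure ?M E = ?f E" if "E \<in> jordan_sets" for E
    using ms that \<mu> by (subst emeasure_measure_of_sigma) (auto simp: measure_space_def)
  moreover have "jordan_sets \<subseteq> Pow X" by (rule space_closed)
  ultimately show ?thesis
    by (intro exI[of _ ?M]) (simp add: space_measure_of_conv sigma_sets_sigma_sets_eq
        sigma_algebra.sets_measure_of_eq[OF sigma_algebra_sigma_sets])
qed

text \<open>
  The upper and the lower measure of \<open>{f \<le> t}\<close> can differ only at a discontinuity of the monotone
  function \<open>G\<close>, the lower measure as a function of \<open>t\<close>: a continuous ramp between the levels \<open>t\<close> and
  \<open>t + h\<close> bounds the upper measure at \<open>t\<close> by \<open>G (t + h)\<close>. Monotone functions have only countably many
  discontinuities.
\<close>

lemma jordan_level_between:
  fixes f :: "'b \<Rightarrow> real"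
  assumes f: "continuous_on X f" and "a < b"
  shows "\<exists>t. a < t \<and> t < b \<and> {p\<in>X. f p \<le> t} \<in> jordan_sets"
proof -
  define E where "E t = {p\<in>X. f p \<le> t}" for t
  define S where "S t = {L x | x. \<forall>p\<in>X. ev x p \<le> indicator (E t) p}" for t
  define G where "G t = Sup (S t)" for t
  have nonempty: "S t \<noteq> {}" for t
  proof -
    have "L 0 \<in> S t" unfolding S_def using linear_0[OF ev_linear] by (auto intro!: exI[of _ 0])
    then show ?thesis by blast
  qed
  have bdd: "bdd_above (S t)" for t
  proof (rule bdd_aboveI)
    fix c assume "c \<in> S t"
    then obtain x where x: "c = L x" "\<forall>p\<in>X. ev x p \<le> indicator (E t) p" by (auto simp: S_def)
    have "ev x p \<le> ev e p" if "p \<in> X" for p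
    proof -
      have "ev x p \<le> indicator (E t) p" using x(2) that by blast
      also have "\<dots> \<le> ev e p" by (simp add: ev_unit that indicator_def)
      finally show ?thesis .
    qed
    then show "c \<le> L e" unfolding x(1) by (rule L_mono)
  qed
  have "mono G"
  proof (rule monoI)
    fix s t :: real assume "s \<le> t"
    then have "indicator (E s) p \<le> (indicator (E t) p :: real)" for p by (auto simp: E_def indicator_def)
    then have "S s \<subseteq> S t" unfolding S_def by (blast intro: order_trans)
    then show "G s \<le> G t" unfolding G_def by (intro cSup_subset_mono nonempty bdd)
  qed
  then have "countable {t. \<not> isCont G t}" by (rule mono_ctble_discont)
  then have "uncountable ({a<..<b} - {t. \<not> isCont G t})"
    using \<open>a < b\<close> by (intro uncountable_minus_countable) (simp_all add: uncountable_open_interval)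
  then have "{a<..<b} - {t. \<not> isCont G t} \<noteq> {}" by (metis countable_empty)
  then obtain t where t: "a < t" "t < b" "isCont G t" by auto
  have "\<exists>c. has_mean (indicator (E t)) c"
  proof (rule has_mean_sandwich)
    fix \<epsilon> :: real assume "0 < \<epsilon>"
    then obtain \<delta> where \<delta>: "0 < \<delta>" "\<And>s. \<bar>s - t\<bar> < \<delta> \<Longrightarrow> \<bar>G s - G t\<bar> < \<epsilon> / 2"
      using t(3) unfolding continuous_at_eps_delta dist_real_def by (meson half_gt_zero)
    define h where "h = \<delta> / 2"
    have "0 < h" using \<delta> by (simp add: h_def)
    define \<phi> where "\<phi> p = max 0 (min 1 ((t + h - f p) / h))" for p
    have "continuous_on X \<phi>" unfolding \<phi>_def using \<open>0 < h\<close>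
      by (intro continuous_on_max continuous_on_min continuous_intros f) auto
    then obtain d where d: "has_mean \<phi> d" using has_mean_continuous by blast
    have \<phi>: "indicator (E t) p \<le> \<phi> p" "\<phi> p \<le> indicator (E (t + h)) p" if "p \<in> X" for p
      using that \<open>0 < h\<close> by (auto simp: \<phi>_def E_def indicator_def field_simps max_def min_def)
    have "d \<le> G (t + h)"
    proof (rule field_le_epsilon)
      fix \<eta> :: real assume "0 < \<eta>"
      then obtain x where x: "\<And>p. p \<in> X \<Longrightarrow> ev x p \<le> \<phi> p" "d - \<eta> \<le> L x"
        using has_meanE[OF d] by metis
      have "L x \<in> S (t + h)" unfolding S_def using x(1) \<phi>(2) by (blast intro: order_trans)
      then have "L x \<le> G (t + h)" unfolding G_def by (intro cSup_upper bdd)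
      then show "d \<le> G (t + h) + \<eta>" using x(2) by simp
    qed
    moreover have "G (t + h) - G t \<le> \<epsilon> / 2"
      using \<delta>(2)[of "t + h"] \<delta>(1) unfolding h_def abs_less_iff by simp
    moreover obtain x where x: "G t - \<epsilon> / 2 < L x" "\<forall>p\<in>X. ev x p \<le> indicator (E t) p"
    proof -
      have "G t - \<epsilon> / 2 < Sup (S t)" using \<open>0 < \<epsilon>\<close> by (simp add: G_def)
      then show ?thesis using less_cSupE[OF _ nonempty] that unfolding S_def by blast
    qed
    ultimately have "d - L x \<le> \<epsilon>" by simp
    then show "\<exists>g h c d. has_mean g c \<and> has_mean h d \<and>
        (\<forall>p\<in>X. g p \<le> indicator (E t) p \<and> indicator (E t) p \<le> h p) \<and> d - c \<le> \<epsilon>"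
      using has_mean_ev[of x] d x(2) \<phi>(1) by blast
  qed
  then show ?thesis using t by (auto simp: jordan_sets_def E_def)
qed

text \<open>
  A closed set is the zero set of some \<open>f \<ge> 0\<close>, thus the intersection of sublevel sets at levels that
  tend to \<open>0\<close>, and these levels can be chosen so that the sublevel sets are Jordan sets.
\<close>

lemma closed_in_sigma_jordan:
  assumes "closed C"
  shows "X \<inter> C \<in> sigma_sets X jordan_sets"
proof -
  obtain f :: "'b \<Rightarrow> real" where f: "continuous_on X f" "\<forall>p\<in>X. 0 \<le> f p \<and> (f p = 0 \<longleftrightarrow> p \<in> C)"
    using zero_sets[OF assms] by blast
  have "\<exists>t. 0 < t \<and> t < inverse (real (Suc n)) \<and> {p\<in>X. f p \<le> t} \<in> jordan_sets" for n
    by (rule jordan_level_between[OF f(1)]) simp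
  then obtain t where t: "\<And>n. 0 < t n" "\<And>n. t n < inverse (real (Suc n))"
    "\<And>n. {p\<in>X. f p \<le> t n} \<in> jordan_sets" by metis
  have "X \<inter> C = (\<Inter>n. {p\<in>X. f p \<le> t n})"
  proof (intro equalityI subsetI)
    fix p assume p: "p \<in> (\<Inter>n. {p\<in>X. f p \<le> t n})"
    then have "p \<in> X" and le: "\<And>n. f p \<le> t n" by auto
    have "f p \<le> 0"
    proof (rule ccontr)
      assume "\<not> f p \<le> 0"
      then obtain n where "inverse (real (Suc n)) < f p" using reals_Archimedean by (metis not_le)
      then show False using le[of n] t(2)[of n] by simp
    qed
    then show "p \<in> X \<inter> C" using f(2) \<open>p \<in> X\<close> by force
  next
    fix p assume "p \<in> X \<inter> C"
    then have "f p = 0" "p \<in> X" using f(2) by auto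
    then show "p \<in> (\<Inter>n. {p\<in>X. f p \<le> t n})" using t(1) by (simp add: less_imp_le)
  qed
  also have "\<dots> \<in> sigma_sets X jordan_sets"
    using t(3) by (intro sigma_sets_Inter) (auto simp: jordan_sets_def)
  finally show ?thesis .
qed

text \<open>
  Both integrals are linear and monotone and agree on indicators of Jordan sets, hence on staircase
  functions, and a continuous function is uniformly close to a staircase whose levels have Jordan sublevel sets.
\<close>

lemma integral_eq_mean:
  fixes f :: "'b \<Rightarrow> real"
  assumes M: "space M = X" "sets M = sigma_sets X jordan_sets"
    "\<And>E. E \<in> jordan_sets \<Longrightarrow> emeasure M E = ennreal (mean (indicator E))"
    and f: "continuous_on X f" and meas: "f \<in> borel_measurable M" and c: "has_mean f c"
  shows "integrable M f \<and> integral\<^sup>L M f = c"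
proof -
  interpret finite_measure M using M jordan_space by (intro finite_measureI) simp
  have mean_X: "mean (indicator X) = L e" by (rule mean_eq[OF has_mean_indicator_space])
  have jordan_integral: "has_bochner_integral M (indicator E) (mean (indicator E))" if "E \<in> jordan_sets" for E
    using that M has_bochner_integral_real_indicator[of E M]
    by (auto simp: measure_def mean_indicator_nonneg)
  have measure_X: "measure M X = L e"
    using M(3)[OF jordan_space] mean_eq[OF has_mean_indicator_space] L_unit_nonneg by (simp add: measure_def)
  obtain B where B: "0 < B" "\<And>p. p \<in> X \<Longrightarrow> \<bar>f p\<bar> < B"
  proof -
    have "bounded (f ` X)" by (intro compact_imp_bounded compact_continuous_image f compact)
    then obtain B where "\<forall>y\<in>f ` X. norm y \<le> B" by (auto simp: bounded_iff)
    then show ?thesis using that[of "\<bar>B\<bar> + 1"] by force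
  qed
  have int_f: "integrable M f"
    using B meas M(1) by (intro integrable_const_bound[where B = B]) (auto intro: less_imp_le)
  have close: "\<bar>integral\<^sup>L M f - c\<bar> \<le> \<epsilon> * (4 * L e)" if "0 < \<epsilon>" for \<epsilon>
  proof -
    \<comment> \<open>a level with Jordan sublevel set in each interval of a partition; consecutive levels differ by at most twice the mesh\<close>
    have "\<exists>t. - B + (real k - 1) * \<epsilon> < t \<and> t < - B + real k * \<epsilon> \<and> {p\<in>X. f p \<le> t} \<in> jordan_sets" for k
      using \<open>0 < \<epsilon>\<close> by (intro jordan_level_between f) (simp add: algebra_simps)
    then obtain t where t: "\<And>k. - B + (real k - 1) * \<epsilon> < t k" "\<And>k. t k < - B + real k * \<epsilon>"
      "\<And>k. {p\<in>X. f p \<le> t k} \<in> jordan_sets" by metis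
    have t_step: "t k \<le> t (Suc k)" "t (Suc k) \<le> t k + 2 * \<epsilon>" for k
      using t(1)[of k] t(2)[of k] t(1)[of "Suc k"] t(2)[of "Suc k"] by (simp_all add: algebra_simps)
    obtain n0 where "2 * B / \<epsilon> < real n0" using reals_Archimedean2 by blast
    then have n0: "B < t (Suc n0)" using t(1)[of "Suc n0"] \<open>0 < \<epsilon>\<close> by (simp add: field_simps)
    define n where "n = Suc n0"
    define E where "E k = X - {p\<in>X. f p \<le> t k}" for k
    have E: "E k \<in> jordan_sets" for k unfolding E_def by (intro jordan_diff jordan_space t(3))
    define H where "H p = t 0 * indicator X p + (\<Sum>k<n. (t (Suc k) - t k) * indicator (E k) p)" for p
    define d where "d = t 0 * L e + (\<Sum>k<n. (t (Suc k) - t k) * mean (indicator (E k)))"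
    have H_int: "has_bochner_integral M H d"
      unfolding H_def d_def
      unfolding mean_X[symmetric]
      by (intro has_bochner_integral_add has_bochner_integral_sum has_bochner_integral_mult_right
          jordan_integral E jordan_space)
    have H_mean: "has_mean H d"
      unfolding H_def d_def
    proof (rule has_mean_add)
      show "has_mean (\<lambda>p. t 0 * indicator X p) (t 0 * L e)"
        by (rule has_mean_cong[OF has_mean_const]) simp
      show "has_mean (\<lambda>p. \<Sum>k<n. (t (Suc k) - t k) * indicator (E k) p)
          (\<Sum>k<n. (t (Suc k) - t k) * mean (indicator (E k)))"
        using t_step by (intro has_mean_sum has_mean_scale_nonneg has_mean_jordan E) auto
    qed
    have near: "f p \<le> H p \<and> H p \<le> f p + 2 * \<epsilon>" if "p \<in> X" for p
    proof -
      have "t 0 < f p" using t(2)[of 0] B(2)[OF that] by simp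
      moreover have "f p \<le> t n" using n0 B(2)[OF that] by (simp add: n_def)
      moreover have "indicator (E k) p = (if t k < f p then 1 else (0::real))" for k
        using that by (simp add: E_def indicator_def not_le)
      then have "H p = t 0 + (\<Sum>k<n. (t (Suc k) - t k) * (if t k < f p then 1 else 0))"
        using that by (simp add: H_def)
      ultimately show ?thesis using staircase_approximation[of t "2 * \<epsilon>" "f p" n] t_step by simp
    qed
    have H: "integrable M H" "integral\<^sup>L M H = d"
      using H_int by (auto simp: has_bochner_integral_iff)
    have "c \<le> d" using near by (intro has_mean_mono[OF c H_mean]) auto
    moreover have "d \<le> c + (2 * \<epsilon>) * L e"
      using near by (intro has_mean_mono[OF H_mean has_mean_add[OF c has_mean_const]]) auto
    moreover have "integral\<^sup>L M f \<le> d"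
      using near M(1) integral_mono[OF int_f H(1)] H(2) by auto
    moreover have "d \<le> integral\<^sup>L M f + (2 * \<epsilon>) * L e"
    proof -
      have "integral\<^sup>L M H \<le> integral\<^sup>L M (\<lambda>p. f p + 2 * \<epsilon>)"
        using near M(1) int_f H(1) by (intro integral_mono) auto
      also have "\<dots> = integral\<^sup>L M f + (2 * \<epsilon>) * L e"
        using int_f measure_X M(1) by (simp add: mult.commute)
      finally show ?thesis using H(2) by simp
    qed
    ultimately show ?thesis using \<open>0 < \<epsilon>\<close> L_unit_nonneg by (simp add: abs_le_iff algebra_simps)
  qed
  have "integral\<^sup>L M f = c"
  proof (rule ccontr)
    assume "integral\<^sup>L M f \<noteq> c"
    define D where "D = \<bar>integral\<^sup>L M f - c\<bar>"
    have "0 < D" using \<open>integral\<^sup>L M f \<noteq> c\<close> by (simp add: D_def)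
    define \<epsilon> where "\<epsilon> = D / (8 * (L e + 1))"
    have "0 < \<epsilon>" using \<open>0 < D\<close> L_unit_nonneg by (simp add: \<epsilon>_def)
    have "D \<le> \<epsilon> * (4 * L e)" using close[OF \<open>0 < \<epsilon>\<close>] by (simp add: D_def)
    also have "\<dots> \<le> \<epsilon> * (4 * (L e + 1))" using \<open>0 < \<epsilon>\<close> by simp
    also have "\<dots> = D / 2" using L_unit_nonneg by (simp add: \<epsilon>_def divide_eq_eq eq_divide_eq)
    finally show False using \<open>0 < D\<close> by simp
  qed
  then show ?thesis using int_f by blast
qed

text \<open>
  The Caratheodory extension lives on the sigma-algebra generated by the Jordan sets, which may contain
  more than Borel sets; its image under the identity is a Borel measure.
\<close>

theorem representing_measure_exists:
  "\<exists>\<nu>. sets \<nu> = sets (restrict_space borel X) \<and> finite_measure \<nu> \<and>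
     (\<forall>x. integrable \<nu> (ev x) \<and> integral\<^sup>L \<nu> (ev x) = L x)"
proof -
  obtain M where M: "space M = X" "sets M = sigma_sets X jordan_sets"
    "\<And>E. E \<in> jordan_sets \<Longrightarrow> emeasure M E = ennreal (mean (indicator E))"
    using jordan_measure_exists by metis
  have "(\<lambda>p. p) \<in> measurable M borel"
  proof (rule borel_measurableI)
    fix S :: "'b set" assume "open S"
    have "(\<lambda>p. p) -` S \<inter> space M = space M - X \<inter> (- S)" using M(1) by auto
    also have "\<dots> \<in> sets M"
      using closed_in_sigma_jordan[of "- S"] \<open>open S\<close> M(2) by (intro sets.compl_sets) auto
    finally show "(\<lambda>p. p) -` S \<inter> space M \<in> sets M" .
  qed
  then have id: "(\<lambda>p. p) \<in> measurable M (restrict_space borel X)"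
    using M(1) by (intro measurable_restrict_space2) auto
  let ?N = "distr M (restrict_space borel X) (\<lambda>p. p)"
  have meas: "ev x \<in> borel_measurable (restrict_space borel X)" for x
    by (intro borel_measurable_continuous_on_restrict ev_continuous)
  have "integrable M (ev x) \<and> integral\<^sup>L M (ev x) = L x" for x
    using measurable_compose[OF id meas] by (intro integral_eq_mean[OF M ev_continuous _ has_mean_ev]) auto
  then have "integrable ?N (ev x) \<and> integral\<^sup>L ?N (ev x) = L x" for x
    by (simp add: integrable_distr_eq[OF id meas] integral_distr[OF id meas])
  moreover have "finite_measure ?N"
  proof -
    interpret finite_measure M using M jordan_space by (intro finite_measureI) simp
    show ?thesis by (rule finite_measure_distr[OF id])
  qed
  ultimately show ?thesis by (intro exI[of _ ?N]) simp
qed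

lemma integral_continuous_eq_of_ev:
  fixes f :: "'b \<Rightarrow> real"
  assumes sets: "sets \<mu> = sets (restrict_space borel X)" "sets \<nu> = sets (restrict_space borel X)"
    and fin: "finite_measure \<mu>" "finite_measure \<nu>"
    and eq: "\<And>x. integral\<^sup>L \<mu> (ev x) = integral\<^sup>L \<nu> (ev x)"
    and f: "continuous_on X f"
  shows "integral\<^sup>L \<mu> f = integral\<^sup>L \<nu> f"
proof -
  have integrable: "integrable M g"
    if "sets M = sets (restrict_space borel X)" "finite_measure M" "continuous_on X g"
    for M and g :: "'b \<Rightarrow> real"
  proof -
    have "bounded (g ` X)" by (intro compact_imp_bounded compact_continuous_image that compact)
    then obtain B where B: "\<forall>y\<in>g ` X. norm y \<le> B" by (auto simp: bounded_iff)
    have "space M = X" using sets_eq_imp_space_eq[OF that(1)] by (simp add: space_restrict_space)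
    moreover have "g \<in> borel_measurable M"
      using borel_measurable_continuous_on_restrict[OF that(3)] measurable_cong_sets[OF that(1) refl] by blast
    ultimately show ?thesis
      using B by (intro finite_measure.integrable_const_bound[OF that(2), where B = B]) auto
  qed
  have approx: "\<bar>integral\<^sup>L M f - integral\<^sup>L M (ev x)\<bar> \<le> \<epsilon> * measure M X"
    if M: "sets M = sets (restrict_space borel X)" "finite_measure M" and x: "\<forall>p\<in>X. \<bar>f p - ev x p\<bar> < \<epsilon>"
    for M x \<epsilon>
  proof -
    interpret finite_measure M by fact
    have space: "space M = X" using sets_eq_imp_space_eq[OF M(1)] by (simp add: space_restrict_space)
    have int: "integrable M f" "integrable M (ev x)"
      by (intro integrable M f ev_continuous)+
    have "\<bar>integral\<^sup>L M f - integral\<^sup>L M (ev x)\<bar> = \<bar>integral\<^sup>L M (\<lambda>p. f p - ev x p)\<bar>"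
      using int by simp
    also have "\<dots> \<le> integral\<^sup>L M (\<lambda>p. \<bar>f p - ev x p\<bar>)" by (rule integral_abs_bound)
    also have "\<dots> \<le> integral\<^sup>L M (\<lambda>p. \<epsilon>)"
      using int x space by (intro integral_mono) (auto intro: less_imp_le)
    also have "\<dots> = \<epsilon> * measure M X" by (simp add: space mult.commute)
    finally show ?thesis .
  qed
  show ?thesis
  proof (rule ccontr)
    assume "integral\<^sup>L \<mu> f \<noteq> integral\<^sup>L \<nu> f"
    define D where "D = \<bar>integral\<^sup>L \<mu> f - integral\<^sup>L \<nu> f\<bar>"
    have "0 < D" using \<open>integral\<^sup>L \<mu> f \<noteq> integral\<^sup>L \<nu> f\<close> by (simp add: D_def)
    define m where "m = measure \<mu> X + measure \<nu> X + 1"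
    have "0 < m" by (simp add: m_def add_nonneg_pos)
    then have "0 < D / m" using \<open>0 < D\<close> by simp
    then obtain x where x: "\<forall>p\<in>X. \<bar>f p - ev x p\<bar> < D / m" using dense[OF f] by blast
    have "D \<le> D / m * (measure \<mu> X + measure \<nu> X)"
      using approx[OF sets(1) fin(1) x] approx[OF sets(2) fin(2) x] eq[of x]
      by (simp add: D_def distrib_left)
    also have "\<dots> < D / m * m" using \<open>0 < D / m\<close> by (intro mult_strict_left_mono) (simp_all add: m_def)
    also have "\<dots> = D" using \<open>0 < m\<close> by simp
    finally show False by simp
  qed
qed

text \<open>
  By density two such measures agree on continuous functions. If \<open>f \<ge> 0\<close> has zero set \<open>C\<close>, the functions
  \<open>max 0 (1 - n * f)\<close> decrease to the indicator of \<open>C\<close>, so the measures agree on closed sets, and these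
  form a generator that is stable under intersection.
\<close>

theorem representing_measure_unique:
  assumes sets: "sets \<mu> = sets (restrict_space borel X)" "sets \<nu> = sets (restrict_space borel X)"
    and fin: "finite_measure \<mu>" "finite_measure \<nu>"
    and eq: "\<And>x. integral\<^sup>L \<mu> (ev x) = integral\<^sup>L \<nu> (ev x)"
  shows "\<mu> = \<nu>"
proof -
  let ?E = "(\<inter>) X ` Collect closed"
  have closed_meas: "X \<inter> C \<in> sets (restrict_space borel X)" if "closed C" for C
    using that by (auto simp: sets_restrict_space)
  have cut_limit: "(\<lambda>n. integral\<^sup>L M (\<lambda>p. max 0 (1 - real n * f p))) \<longlonglongrightarrow> measure M (X \<inter> C)"
    if M: "sets M = sets (restrict_space borel X)" "finite_measure M" and "closed C"
      and f: "continuous_on X f" "\<forall>p\<in>X. 0 \<le> f p \<and> (f p = 0 \<longleftrightarrow> p \<in> C)" for M C f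
  proof -
    interpret finite_measure M by fact
    have space: "space M = X" using sets_eq_imp_space_eq[OF M(1)] by (simp add: space_restrict_space)
    have CM: "X \<inter> C \<in> sets M" using closed_meas[OF \<open>closed C\<close>] M(1) by simp
    have "(\<lambda>n. integral\<^sup>L M (\<lambda>p. max 0 (1 - real n * f p))) \<longlonglongrightarrow> integral\<^sup>L M (indicator (X \<inter> C))"
    proof (rule integral_dominated_convergence[where w = "\<lambda>_. 1"])
      show "indicator (X \<inter> C) \<in> borel_measurable M" using CM by simp
      show "(\<lambda>p. max 0 (1 - real n * f p)) \<in> borel_measurable M" for n
        using borel_measurable_continuous_on_restrict[OF continuous_on_max[OF continuous_on_const
            continuous_on_diff[OF continuous_on_const continuous_on_mult_left[OF f(1)]]], of 0 1 "real n"]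
          measurable_cong_sets[OF M(1) refl] by blast
      show "AE p in M. (\<lambda>n. max 0 (1 - real n * f p)) \<longlonglongrightarrow> indicator (X \<inter> C) p"
      proof (rule AE_I2)
        fix p assume "p \<in> space M"
        then have p: "p \<in> X" using space by simp
        show "(\<lambda>n. max 0 (1 - real n * f p)) \<longlonglongrightarrow> indicator (X \<inter> C) p"
        proof (cases "p \<in> C")
          case True
          moreover have "f p = 0" using True f(2) p by blast
          ultimately show ?thesis using p by simp
        next
          case False
          then have "0 < f p" using f(2) p by (auto simp: order_less_le)
          then obtain N where N: "1 < real N * f p" using reals_Archimedean3 by blast
          have "max 0 (1 - real n * f p) = 0" if "N \<le> n" for n
          proof -
            have "real N * f p \<le> real n * f p" using that \<open>0 < f p\<close> by simp
            then show ?thesis using N by simp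
          qed
          then have "eventually (\<lambda>n. max 0 (1 - real n * f p) = 0) sequentially"
            by (auto simp: eventually_sequentially)
          then show ?thesis using False by (simp add: tendsto_eventually)
        qed
      qed
      show "AE p in M. norm (max 0 (1 - real n * f p)) \<le> 1" for n
        using f(2) space by (intro AE_I2) simp
    qed simp
    then show ?thesis using CM by simp
  qed
  have measure_closed: "emeasure \<mu> (X \<inter> C) = emeasure \<nu> (X \<inter> C)" if C: "closed C" for C
  proof -
    obtain f :: "'b \<Rightarrow> real" where f: "continuous_on X f" "\<forall>p\<in>X. 0 \<le> f p \<and> (f p = 0 \<longleftrightarrow> p \<in> C)"
      using zero_sets[OF C] by blast
    have "integral\<^sup>L \<mu> (\<lambda>p. max 0 (1 - real n * f p)) = integral\<^sup>L \<nu> (\<lambda>p. max 0 (1 - real n * f p))" for n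
      by (rule integral_continuous_eq_of_ev[OF sets fin eq]) (intro continuous_on_max continuous_intros f(1))
    then have "measure \<mu> (X \<inter> C) = measure \<nu> (X \<inter> C)"
      using cut_limit[OF sets(1) fin(1) C f] cut_limit[OF sets(2) fin(2) C f]
      by (simp add: LIMSEQ_unique)
    then show ?thesis using fin by (simp add: finite_measure.emeasure_eq_measure)
  qed
  have gen: "sets (restrict_space borel X) = sigma_sets X ?E"
  proof -
    have "sets (restrict_space borel X) = (\<inter>) X ` sigma_sets UNIV (Collect closed)"
      by (simp add: sets_restrict_space borel_eq_closed)
    also have "\<dots> = sigma_sets X ?E"
      using compact_imp_closed[OF compact] by (intro sigma_sets_Int) auto
    finally show ?thesis .
  qed
  show ?thesis
  proof (rule measure_eqI_generator_eq[where \<Omega> = X and A = "\<lambda>_. X" and E = ?E])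
    show "Int_stable ?E"
    proof (rule Int_stableI)
      fix A B assume "A \<in> ?E" "B \<in> ?E"
      then obtain C D where "closed C" "closed D" "A = X \<inter> C" "B = X \<inter> D" by auto
      then have "A \<inter> B = X \<inter> (C \<inter> D)" "closed (C \<inter> D)" by auto
      then show "A \<inter> B \<in> ?E" by blast
    qed
    show "range (\<lambda>_. X) \<subseteq> ?E" using image_eqI[of X "(\<inter>) X" UNIV "Collect closed"] by auto
    show "emeasure \<mu> A = emeasure \<nu> A" if "A \<in> ?E" for A
      using that measure_closed by auto
    show "sets \<mu> = sigma_sets X ?E" "sets \<nu> = sigma_sets X ?E" using sets gen by auto
    show "emeasure \<mu> X \<noteq> \<infinity>" using fin(1) by (simp add: finite_measure.emeasure_finite)
  qed auto
qed

end

section \<open>Hausdorff and metrizable spaces of functions\<close>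

text \<open>
  Separation of points by open sets passes from the factors to a product. The instances are stated
  for each separation class in turn because an instance for a class has to be at least as general as
  those that are known for its subclasses.
\<close>

lemma open_coordinate_preimage: "open U \<Longrightarrow> open {h :: 'a \<Rightarrow> 'b::topological_space. h x \<in> U}"
  using product_topology_basis'[of "{()}" "\<lambda>_. U" "\<lambda>_. x"] by simp

instance "fun" :: (type, t0_space) t0_space
proof
  fix f g :: "'a \<Rightarrow> 'b" assume "f \<noteq> g"
  then obtain x where "f x \<noteq> g x" by auto
  from Topological_Spaces.t0_space[OF this] obtain U where "open U" "\<not> (f x \<in> U \<longleftrightarrow> g x \<in> U)" by auto
  then show "\<exists>U. open U \<and> \<not> (f \<in> U \<longleftrightarrow> g \<in> U)"
    by (intro exI[of _ "{h. h x \<in> U}"]) (auto intro: open_coordinate_preimage)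
qed

instance "fun" :: (type, t1_space) t1_space
proof
  fix f g :: "'a \<Rightarrow> 'b" assume "f \<noteq> g"
  then obtain x where "f x \<noteq> g x" by auto
  then obtain U where "open U" "f x \<in> U" "g x \<notin> U" using t1_space[OF \<open>f x \<noteq> g x\<close>] by auto
  then show "\<exists>U. open U \<and> f \<in> U \<and> g \<notin> U"
    by (intro exI[of _ "{h. h x \<in> U}"]) (auto intro: open_coordinate_preimage)
qed

instance "fun" :: (type, t2_space) t2_space
proof
  fix f g :: "'a \<Rightarrow> 'b" assume "f \<noteq> g"
  then obtain x where "f x \<noteq> g x" by auto
  then obtain U V where "open U" "open V" "f x \<in> U" "g x \<in> V" "U \<inter> V = {}"
    using hausdorff[OF \<open>f x \<noteq> g x\<close>] by auto
  then show "\<exists>U V. open U \<and> open V \<and> f \<in> U \<and> g \<in> V \<and> U \<inter> V = {}"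
    by (intro exI[of _ "{h. h x \<in> U}"] exI[of _ "{h. h x \<in> V}"]) (auto intro: open_coordinate_preimage)
qed

text \<open>
  The distance to the image of \<open>C\<close>, pulled back along an embedding of \<open>X\<close> into a metric space.
\<close>

lemma closed_is_zero_set_of_metrizable:
  fixes g :: "'b::t2_space \<Rightarrow> 'c::metric_space"
  assumes "compact X" and g: "continuous_on X g" "inj_on g X" and "closed C"
  shows "\<exists>f :: 'b \<Rightarrow> real. continuous_on X f \<and> (\<forall>p\<in>X. 0 \<le> f p \<and> (f p = 0 \<longleftrightarrow> p \<in> C))"
proof (cases "X \<inter> C = {}")
  case True
  then show ?thesis by (intro exI[of _ "\<lambda>_. 1"]) auto
next
  case False
  define D where "D = g ` (X \<inter> C)"
  have "compact D" unfolding D_def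
    by (intro compact_continuous_image compact_Int_closed assms continuous_on_subset[OF g(1)]) auto
  have "infdist (g p) D = 0 \<longleftrightarrow> p \<in> C" if "p \<in> X" for p
  proof -
    have "infdist (g p) D = 0 \<longleftrightarrow> g p \<in> D"
      using compact_imp_closed[OF \<open>compact D\<close>] False by (simp add: in_closed_iff_infdist_zero D_def)
    also have "\<dots> \<longleftrightarrow> p \<in> C" using that g(2) by (auto simp: D_def inj_on_def)
    finally show ?thesis .
  qed
  then show ?thesis
    by (intro exI[of _ "\<lambda>p. infdist (g p) D"]) (auto intro: continuous_on_infdist g infdist_nonneg)
qed

text \<open>
  Inner regularity is known for finite Borel measures on complete separable metric spaces, and the
  embedding \<open>g\<close> transports it back to \<open>X\<close>: a continuous injection on a compact space is a homeomorphism
  onto its image.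
\<close>

lemma inner_regular_of_metrizable:
  fixes g :: "'b::t2_space \<Rightarrow> 'c::{second_countable_topology, complete_space}"
  assumes X: "compact X" and g: "continuous_on X g" "inj_on g X"
    and sets: "sets M = sets (restrict_space borel X)" and fin: "finite_measure M" and B: "B \<in> sets M"
  shows "emeasure M B = (SUP C\<in>{C. compact C \<and> C \<subseteq> B}. emeasure M C)"
proof -
  interpret finite_measure M by fact
  have space: "space M = X" using sets_eq_imp_space_eq[OF sets] by (simp add: space_restrict_space)
  have "B \<subseteq> X" using sets.sets_into_space[OF B] space by simp
  have g_meas: "g \<in> measurable M borel"
    using borel_measurable_continuous_on_restrict[OF g(1)] measurable_cong_sets[OF sets refl] by blast
  define N where "N = distr M borel g"
  define h where "h = the_inv_into X g"
  have h: "continuous_on (g ` X) h" unfolding h_def by (rule continuous_on_inv_into[OF g(1) X g(2)])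
  have hg: "h (g p) = p" if "p \<in> X" for p unfolding h_def by (rule the_inv_into_f_f[OF g(2) that])
  have "closed (g ` X)" by (intro compact_imp_closed compact_continuous_image g X)
  have image: "g ` B \<in> sets borel"
  proof -
    have "h \<in> measurable (restrict_space borel (g ` X)) (restrict_space borel X)"
      using hg by (intro measurable_restrict_space2 borel_measurable_continuous_on_restrict h)
        (auto simp: space_restrict_space)
    then have "h -` B \<inter> space (restrict_space borel (g ` X)) \<in> sets (restrict_space borel (g ` X))"
      using B sets by (intro measurable_sets) auto
    moreover have "h -` B \<inter> space (restrict_space borel (g ` X)) = g ` B"
      using hg \<open>B \<subseteq> X\<close> by (force simp: space_restrict_space)
    ultimately show ?thesis
      using \<open>closed (g ` X)\<close> by (auto simp: sets_restrict_space)
  qed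
  have emeasure_N: "emeasure N (g ` A) = emeasure M A" if "A \<subseteq> X" "g ` A \<in> sets borel" for A
  proof -
    have "g -` g ` A \<inter> X = A" using that(1) g(2) by (auto simp: inj_on_def)
    then show ?thesis using that(2) g_meas by (simp add: N_def emeasure_distr space)
  qed
  have "emeasure M B = emeasure N (g ` B)" using emeasure_N[OF \<open>B \<subseteq> X\<close> image] by simp
  also have "\<dots> = (SUP D\<in>{D. D \<subseteq> g ` B \<and> compact D}. emeasure N D)"
  proof (rule inner_regular)
    have "finite_measure N" unfolding N_def by (rule finite_measure_distr[OF g_meas])
    then show "emeasure N (space N) \<noteq> \<infinity>" by (simp add: finite_measure.emeasure_finite)
  qed (simp_all add: N_def image)
  also have "\<dots> \<le> (SUP C\<in>{C. compact C \<and> C \<subseteq> B}. emeasure M C)"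
  proof (rule SUP_mono)
    fix D assume "D \<in> {D. D \<subseteq> g ` B \<and> compact D}"
    then have D: "D \<subseteq> g ` B" "compact D" by auto
    have "compact (h ` D)"
      using D \<open>B \<subseteq> X\<close> by (intro compact_continuous_image continuous_on_subset[OF h]) auto
    moreover have "h ` D \<subseteq> B" using D(1) hg \<open>B \<subseteq> X\<close> by force
    moreover have "g ` h ` D = D" using D(1) hg \<open>B \<subseteq> X\<close> by (force simp: image_image)
    then have "emeasure N D = emeasure M (h ` D)"
      using emeasure_N[of "h ` D"] D \<open>h ` D \<subseteq> B\<close> \<open>B \<subseteq> X\<close> by (simp add: compact_imp_closed)
    ultimately show "\<exists>C\<in>{C. compact C \<and> C \<subseteq> B}. emeasure N D \<le> emeasure M C" by auto
  qed
  finally have "emeasure M B \<le> (SUP C\<in>{C. compact C \<and> C \<subseteq> B}. emeasure M C)" .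
  moreover have "(SUP C\<in>{C. compact C \<and> C \<subseteq> B}. emeasure M C) \<le> emeasure M B"
    using B by (intro SUP_least emeasure_mono) auto
  ultimately show ?thesis by (rule antisym)
qed

section \<open>Representing measures on the characters of a ball\<close>

lemma characters_eqI:
  assumes gen: "generates_algebra G" and \<alpha>: "\<alpha> \<in> characters" and \<beta>: "\<beta> \<in> characters"
    and eq: "\<And>g. g \<in> G \<Longrightarrow> \<alpha> g = \<beta> g"
  shows "\<alpha> = \<beta>"
proof
  fix x
  show "\<alpha> x = \<beta> x" using gen
    by (induction x rule: generates_algebra_induct)
      (use \<alpha> \<beta> eq in \<open>auto simp: characters_def linear_0 linear_add linear_scale\<close>)
qed

text \<open>
  Evaluations at the elements of the algebra form an algebra of functions on \<open>X\<close>, with pointwise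
  operations because the points are multiplicative, and distinct points differ at some element. The
  Stone--Weierstrass theorem applies.
\<close>

lemma characters_dense:
  assumes X: "compact X" "X \<subseteq> characters" and f: "continuous_on X f" and "0 < \<epsilon>"
  shows "\<exists>x. \<forall>\<alpha>\<in>X. \<bar>f \<alpha> - \<alpha> x\<bar> < \<epsilon>"
proof -
  \<comment> \<open>agreement on X suffices, since the evaluations are linear and multiplicative only at characters\<close>
  define R where "R = {f :: ('a \<Rightarrow> real) \<Rightarrow> real. \<exists>x. \<forall>\<alpha>\<in>X. f \<alpha> = \<alpha> x}"
  have RI: "h \<in> R" if "\<And>\<alpha>. \<alpha> \<in> X \<Longrightarrow> h \<alpha> = \<alpha> x" for h x using that by (auto simp: R_def)
  have char: "linear \<alpha>" "\<alpha> 1 = 1" "\<alpha> (x * y) = \<alpha> x * \<alpha> y" if "\<alpha> \<in> X" for \<alpha> x y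
    using X(2) that by (auto simp: characters_def)
  interpret function_ring_on R X
  proof
    show "compact X" by fact
    fix h assume "h \<in> R"
    then obtain x where x: "\<And>\<alpha>. \<alpha> \<in> X \<Longrightarrow> h \<alpha> = \<alpha> x" by (auto simp: R_def)
    have "continuous_on X (\<lambda>\<alpha>. \<alpha> x)"
      by (rule continuous_on_subset[OF continuous_on_product_coordinates]) simp
    then show "continuous_on X h" using x by (simp cong: continuous_on_cong)
    fix k assume "k \<in> R"
    then obtain y where y: "\<And>\<alpha>. \<alpha> \<in> X \<Longrightarrow> k \<alpha> = \<alpha> y" by (auto simp: R_def)
    show "(\<lambda>\<alpha>. h \<alpha> + k \<alpha>) \<in> R" by (rule RI[of _ "x + y"]) (simp add: x y char linear_add)
    show "(\<lambda>\<alpha>. h \<alpha> * k \<alpha>) \<in> R" by (rule RI[of _ "x * y"]) (simp add: x y char)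
  next
    show "(\<lambda>_. c) \<in> R" for c by (rule RI[of _ "c *\<^sub>R 1"]) (simp add: char linear_scale)
  next
    fix \<alpha> \<beta> assume "\<alpha> \<in> X" "\<beta> \<in> X" "\<alpha> \<noteq> \<beta>"
    then obtain x where "\<alpha> x \<noteq> \<beta> x" by auto
    then show "\<exists>h\<in>R. h \<alpha> \<noteq> h \<beta>" by (intro bexI[of _ "\<lambda>\<alpha>. \<alpha> x"]) (auto intro: RI)
  qed
  obtain h where h: "h \<in> R" "\<forall>\<alpha>\<in>X. \<bar>f \<alpha> - h \<alpha>\<bar> < \<epsilon>"
    using Stone_Weierstrass_basic[OF f \<open>0 < \<epsilon>\<close>] by blast
  obtain x where "\<forall>\<alpha>\<in>X. h \<alpha> = \<alpha> x" using h(1) by (auto simp: R_def)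
  then show ?thesis using h(2) by (intro exI[of _ x]) simp
qed

text \<open>
  The coordinates at the generators embed the ball into a countable power of the line, which is
  metrizable. This provides zero functions for closed sets and inner regularity.
\<close>

theorem moment_functional_representation:
  fixes a :: "'i::countable \<Rightarrow> 'a::{comm_ring_1,real_algebra_1}"
  assumes gen: "generates_algebra (a ` I)" and "finite I" and s: "s = (\<Sum>i\<in>I. (a i)\<^sup>2)" and "0 \<le> \<rho>"
    and L: "L \<in> ball_states s \<rho>"
  shows "\<exists>!\<mu>. radon_measure_on (ball_characters s \<rho>) \<mu> \<and>
    (\<forall>x. integrable \<mu> (\<lambda>\<alpha>. \<alpha> x) \<and> L x = (\<integral>\<alpha>. \<alpha> x \<partial>\<mu>))"
proof -
  let ?K = "ball_characters s \<rho>"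
  have K: "?K \<subseteq> characters" by (auto simp: ball_characters_def)
  have compact: "compact ?K"
    by (intro compact_ball_characters compact_ball_states[OF gen \<open>finite I\<close> s \<open>0 \<le> \<rho>\<close>])
  define g :: "('a \<Rightarrow> real) \<Rightarrow> 'i \<Rightarrow> real" where "g \<alpha> = (\<lambda>i. \<alpha> (a i))" for \<alpha>
  have eval: "continuous_on ?K (\<lambda>\<alpha>. \<alpha> x)" for x
    by (rule continuous_on_subset[OF continuous_on_product_coordinates]) simp
  have g: "continuous_on ?K g"
    unfolding g_def[abs_def] by (rule continuous_on_coordinatewise_then_product) (rule eval)
  have inj: "inj_on g ?K"
  proof (rule inj_onI)
    fix \<alpha> \<beta> assume "\<alpha> \<in> ?K" "\<beta> \<in> ?K" "g \<alpha> = g \<beta>"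
    then show "\<alpha> = \<beta>" using K by (intro characters_eqI[OF gen]) (auto simp: g_def dest: fun_cong)
  qed
  interpret dense_positive_functional ?K "\<lambda>x \<alpha>. \<alpha> x" L 1
  proof (rule dense_positive_functional.intro)
    show "linear (\<lambda>x. \<alpha> x)" "\<alpha> 1 = 1" if "\<alpha> \<in> ?K" for \<alpha>
      using K that by (auto simp: characters_def)
    show "linear L" using L by (simp add: ball_states_def)
    show "0 \<le> L x" if "\<And>\<alpha>. \<alpha> \<in> ?K \<Longrightarrow> 0 \<le> \<alpha> x" for x
      using that by (rule nonneg_of_nonneg_on_ball_characters[OF gen \<open>finite I\<close> s \<open>0 \<le> \<rho>\<close> L])
    show "\<exists>x. \<forall>\<alpha>\<in>?K. \<bar>f \<alpha> - \<alpha> x\<bar> < \<epsilon>" if "continuous_on ?K f" "0 < \<epsilon>" for f \<epsilon>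
      by (rule characters_dense[OF compact K that])
    show "\<exists>f :: ('a \<Rightarrow> real) \<Rightarrow> real. continuous_on ?K f \<and> (\<forall>\<alpha>\<in>?K. 0 \<le> f \<alpha> \<and> (f \<alpha> = 0 \<longleftrightarrow> \<alpha> \<in> C))" if "closed C" for C
      by (rule closed_is_zero_set_of_metrizable[OF compact g inj that])
  qed (fact compact eval)+
  obtain \<nu> where \<nu>: "sets \<nu> = sets (restrict_space borel ?K)" "finite_measure \<nu>"
    "\<And>x. integrable \<nu> (\<lambda>\<alpha>. \<alpha> x)" "\<And>x. (\<integral>\<alpha>. \<alpha> x \<partial>\<nu>) = L x"
    using representing_measure_exists by auto
  have "radon_measure_on ?K \<nu>"
    unfolding radon_measure_on_def
  proof (intro conjI ballI)
    show "\<exists>U. open U \<and> \<alpha> \<in> U \<and> emeasure \<nu> (U \<inter> ?K) < \<infinity>" for \<alpha>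
      using finite_measure.emeasure_finite[OF \<nu>(2)] by (intro exI[of _ UNIV]) (simp add: top.not_eq_extremum)
    show "emeasure \<nu> B = (SUP C\<in>{C. compact C \<and> C \<subseteq> B}. emeasure \<nu> C)" if "B \<in> sets \<nu>" for B
      by (rule inner_regular_of_metrizable[OF compact g inj \<nu>(1,2) that])
  qed (fact \<nu>(1))
  then have "radon_measure_on ?K \<nu> \<and> (\<forall>x. integrable \<nu> (\<lambda>\<alpha>. \<alpha> x) \<and> L x = (\<integral>\<alpha>. \<alpha> x \<partial>\<nu>))"
    using \<nu>(3,4) by simp
  then show ?thesis
  proof (rule ex1I)
    fix \<mu> assume \<mu>: "radon_measure_on ?K \<mu> \<and> (\<forall>x. integrable \<mu> (\<lambda>\<alpha>. \<alpha> x) \<and> L x = (\<integral>\<alpha>. \<alpha> x \<partial>\<mu>))"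
    then have rep: "integrable \<mu> (\<lambda>\<alpha>. \<alpha> x)" "(\<integral>\<alpha>. \<alpha> x \<partial>\<mu>) = L x" for x by simp_all
    have sets: "sets \<mu> = sets (restrict_space borel ?K)"
      using \<mu> unfolding radon_measure_on_def by (elim conjE)
    have space: "space \<mu> = ?K" using sets_eq_imp_space_eq[OF sets] by (simp add: space_restrict_space)
    have "integrable \<mu> (\<lambda>\<alpha>. \<alpha> 1) \<longleftrightarrow> integrable \<mu> (\<lambda>_. 1 :: real)"
      using K by (intro Bochner_Integration.integrable_cong) (auto simp: space characters_def)
    then have "finite_measure \<mu>"
      using rep(1)[of 1] by (intro finite_measureI) (auto simp: integrable_iff_bounded)
    then show "\<mu> = \<nu>"
      by (rule representing_measure_unique[OF sets \<nu>(1) _ \<nu>(2)]) (simp only: rep(2) \<nu>(4))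
  qed
qed

text \<open>
  A functional with a representing measure is nonnegative at every element that is nonnegative on the
  support, in particular at \<open>b\<^sup>2\<close> and at \<open>\<rho> b\<^sup>2 - b\<^sup>2 s\<close>.
\<close>

lemma state_of_representing_measure:
  assumes lin: "linear L" and one: "L 1 = 1" and rad: "radon_measure_on (ball_characters s \<rho>) \<mu>"
    and rep: "\<And>x. L x = (\<integral>\<alpha>. \<alpha> x \<partial>\<mu>)"
  shows "L \<in> ball_states s \<rho>"
proof -
  have sets: "sets \<mu> = sets (restrict_space borel (ball_characters s \<rho>))"
    using rad unfolding radon_measure_on_def by (elim conjE)
  have space: "space \<mu> = ball_characters s \<rho>"
    using sets_eq_imp_space_eq[OF sets] by (simp add: space_restrict_space)
  have nonneg: "0 \<le> L x" if "\<And>\<alpha>. \<alpha> \<in> ball_characters s \<rho> \<Longrightarrow> 0 \<le> \<alpha> x" for x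
    unfolding rep
  proof (intro integral_nonneg_AE AE_I2)
    fix \<alpha> assume "\<alpha> \<in> space \<mu>"
    then have "\<alpha> \<in> ball_characters s \<rho>" by (simp only: space)
    then show "0 \<le> \<alpha> x" by (rule that)
  qed
  have char: "linear \<alpha>" "\<alpha> (b\<^sup>2) = (\<alpha> b)\<^sup>2" "\<alpha> (b\<^sup>2 * s) = (\<alpha> b)\<^sup>2 * \<alpha> s" "\<alpha> s \<le> \<rho>"
    if "\<alpha> \<in> ball_characters s \<rho>" for \<alpha> b
    using that by (auto simp: ball_characters_def characters_def power2_eq_square)
  have "0 \<le> L (b\<^sup>2)" for b
  proof (rule nonneg)
    fix \<alpha> assume "\<alpha> \<in> ball_characters s \<rho>"
    then show "0 \<le> \<alpha> (b\<^sup>2)" using char(2)[of \<alpha> b] by simp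
  qed
  then have "pos_semidef L" by (simp add: pos_semidef_def)
  moreover have "0 \<le> L (\<rho> *\<^sub>R b\<^sup>2 - b\<^sup>2 * s)" for b
  proof (rule nonneg)
    fix \<alpha> assume \<alpha>: "\<alpha> \<in> ball_characters s \<rho>"
    have "\<alpha> (\<rho> *\<^sub>R b\<^sup>2 - b\<^sup>2 * s) = \<rho> * (\<alpha> b)\<^sup>2 - (\<alpha> b)\<^sup>2 * \<alpha> s"
      unfolding linear_diff[OF char(1)[OF \<alpha>]] linear_scale[OF char(1)[OF \<alpha>]] char(2,3)[OF \<alpha>]
      by (simp only: real_scaleR_def)
    also have "\<dots> = (\<alpha> b)\<^sup>2 * (\<rho> - \<alpha> s)" by (simp add: algebra_simps)
    also have "0 \<le> \<dots>" using char(4)[OF \<alpha>] by (intro mult_nonneg_nonneg) simp_all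
    finally show "0 \<le> \<alpha> (\<rho> *\<^sub>R b\<^sup>2 - b\<^sup>2 * s)" .
  qed
  ultimately show ?thesis
    by (simp add: ball_states_def lin one linear_diff[OF lin] linear_scale[OF lin])
qed

theorem proposition4p3:
  fixes a :: "nat \<Rightarrow> 'a::{comm_ring_1,real_algebra_1}"
    and m :: nat and r :: real and L :: "'a \<Rightarrow> real"
    and s :: 'a and K :: "('a \<Rightarrow> real) set"
  assumes "(characters :: ('a \<Rightarrow> real) set) \<noteq> {}"
    and "m \<ge> 1"
    and "generates_algebra (a ` {1..m})"
    and "r > 0"
    and "linear L"
    and "L 1 = 1"
  defines "s \<equiv> \<Sum>i=1..m. (a i)\<^sup>2"
    and "K \<equiv> {\<alpha> \<in> characters. (\<Sum>i=1..m. \<bar>\<alpha> (a i)\<bar>\<^sup>2) \<le> r\<^sup>2}"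
  shows
    "((pos_semidef L \<and> (SUP n\<in>{1..}. ereal (root (2 * n) (L (s ^ (2 * n))))) \<le> ereal (r\<^sup>2))
      \<longleftrightarrow> (pos_semidef L \<and> (\<forall>b. r\<^sup>2 * L (b\<^sup>2) - L (b\<^sup>2 * s) \<ge> 0)))
     \<and>
     ((pos_semidef L \<and> (\<forall>b. r\<^sup>2 * L (b\<^sup>2) - L (b\<^sup>2 * s) \<ge> 0))
      \<longleftrightarrow> (\<exists>!\<mu>. radon_measure_on K \<mu> \<and>
            (\<forall>x. integrable \<mu> (\<lambda>\<alpha>. \<alpha> x) \<and> L x = (\<integral>\<alpha>. \<alpha> x \<partial>\<mu>))))"
proof (intro conjI)
  have s: "s = (\<Sum>i=1..m. (a i)\<^sup>2)" by (simp only: s_def)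
  have "\<alpha> s = (\<Sum>i=1..m. \<bar>\<alpha> (a i)\<bar>\<^sup>2)" if "\<alpha> \<in> characters" for \<alpha>
  proof -
    have "linear \<alpha>" "\<And>x. \<alpha> (x\<^sup>2) = (\<alpha> x)\<^sup>2"
      using that by (auto simp: characters_def power2_eq_square)
    then show ?thesis by (simp add: s linear_sum)
  qed
  then have K: "K = ball_characters s (r\<^sup>2)" by (auto simp: K_def ball_characters_def)
  have bound_iff: "(\<forall>b. r\<^sup>2 * L (b\<^sup>2) - L (b\<^sup>2 * s) \<ge> 0) \<longleftrightarrow> (\<forall>b. L (b\<^sup>2 * s) \<le> r\<^sup>2 * L (b\<^sup>2))"
    by simp
  have states: "L \<in> ball_states s (r\<^sup>2) \<longleftrightarrow> pos_semidef L \<and> (\<forall>b. r\<^sup>2 * L (b\<^sup>2) - L (b\<^sup>2 * s) \<ge> 0)"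
    unfolding bound_iff using assms(5,6) by (simp add: ball_states_def)
  have "0 < r\<^sup>2" using assms(4) by simp
  have growth: "(SUP n\<in>{1..}. ereal (root (2 * n) (L (s ^ (2 * n))))) \<le> ereal (r\<^sup>2)
      \<longleftrightarrow> (\<forall>b. r\<^sup>2 * L (b\<^sup>2) - L (b\<^sup>2 * s) \<ge> 0)" if "pos_semidef L"
    unfolding bound_iff SUP_root_le_iff[OF zero_le_power2]
    by (rule moment_growth_iff_weighted_bound[OF assms(5,6) that \<open>0 < r\<^sup>2\<close> s])
  show "(pos_semidef L \<and> (SUP n\<in>{1..}. ereal (root (2 * n) (L (s ^ (2 * n))))) \<le> ereal (r\<^sup>2))
      \<longleftrightarrow> (pos_semidef L \<and> (\<forall>b. r\<^sup>2 * L (b\<^sup>2) - L (b\<^sup>2 * s) \<ge> 0))"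
    by (rule conj_cong[OF refl growth])
  show "(pos_semidef L \<and> (\<forall>b. r\<^sup>2 * L (b\<^sup>2) - L (b\<^sup>2 * s) \<ge> 0))
      \<longleftrightarrow> (\<exists>!\<mu>. radon_measure_on K \<mu> \<and>
            (\<forall>x. integrable \<mu> (\<lambda>\<alpha>. \<alpha> x) \<and> L x = (\<integral>\<alpha>. \<alpha> x \<partial>\<mu>)))"
    unfolding states[symmetric] K
  proof
    assume "L \<in> ball_states s (r\<^sup>2)"
    then show "\<exists>!\<mu>. radon_measure_on (ball_characters s (r\<^sup>2)) \<mu> \<and>
        (\<forall>x. integrable \<mu> (\<lambda>\<alpha>. \<alpha> x) \<and> L x = (\<integral>\<alpha>. \<alpha> x \<partial>\<mu>))"
      by (rule moment_functional_representation[OF assms(3) finite_atLeastAtMost s zero_le_power2])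
  next
    assume "\<exists>!\<mu>. radon_measure_on (ball_characters s (r\<^sup>2)) \<mu> \<and>
        (\<forall>x. integrable \<mu> (\<lambda>\<alpha>. \<alpha> x) \<and> L x = (\<integral>\<alpha>. \<alpha> x \<partial>\<mu>))"
    then obtain \<mu> where \<mu>: "radon_measure_on (ball_characters s (r\<^sup>2)) \<mu>"
      and rep: "\<forall>x. integrable \<mu> (\<lambda>\<alpha>. \<alpha> x) \<and> L x = (\<integral>\<alpha>. \<alpha> x \<partial>\<mu>)"
      by (elim ex1E conjE)
    show "L \<in> ball_states s (r\<^sup>2)"
      using rep by (intro state_of_representing_measure[OF assms(5,6) \<mu>]) blast
  qed
qed

end
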